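(* Suppose that (A1) for all $b,b'\in\mathcal B$, $\phi(b,t)-\phi(b',t)$ is single-crossing in $t$ and $v(b,t)-v(b',t)$ is monotonic in $t$; and (A2) for all $a,a'\in\Delta(\mathcal B)$, $\phi(a,t)-\phi(a',t)$ is single-crossing in $t$. Let $b^{root}\in\mathcal B$ satisfy: (R1) $\{b^{root}\}=\operatorname{argmax}_{\tilde b\in\mathcal B}Q(\tilde b)$; and (R2) for every $b\in\mathcal B$ that does not contain $b^{root}$ (i.e. $b\not\supseteq b^{root}$), $v(b,\bar t)<v(b^{root},\bar t)$. Suppose also that for all $b_1,b_2$ with $b^{root}\subseteq b_1\subsetneq b_2\subseteq b^*$ one has $v(b_1,\bar t)<v(b_2,\bar t)$, where $b^*=\{1,\dots,n\}$. If there exists a least-favorite good $i$ and the branching condition holds (for this $i$), then the minimal optimal menu of the monopolist's problem is a tree menu; in particular, it contains $\{b^{root},\,b^{root}\cup\{i\},\,b^*\setminus\{i\},\,b^*\}$.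
   Context: Setup. There are $n\ge 1$ goods; $\mathcal B=2^{\{1,\dots,n\}}$ is the set of (deterministic) bundles and $\Delta(\mathcal B)$ is the set of probability distributions on $\mathcal B$ (stochastic bundles); a bundle $b$ is identified with the point mass at $b$. Types $t$ lie in $T=[\underline t,\bar t]\subseteq\mathbb R$, $\underline t<\bar t$, and are distributed according to $F$ with a continuous, positive density $f$. The value function $v:\Delta(\mathcal B)\times T\to\mathbb R$ is continuously differentiable in $t$, with $v(\emptyset,t)=0$ for all $t$ and $v(a,t)=\mathbb E_{b\sim a}[v(b,t)]$. The virtual value function is $\phi(b,t)=v(b,t)-\frac{1-F(t)}{f(t)}v_t(b,t)$, $v_t=\partial v/\partial t$, extended by $\phi(a,t)=\mathbb E_{b\sim a}[\phi(b,t)]$ for $a\in\Delta(\mathcal B)$; note $\phi(b,\bar t)=v(b,\bar t)$. Standing assumptions: for $b\ne b'$ in $\mathcal B$ there is $t\in T$ with $\phi(b,t)\neq\phi(b',t)$; $\max_{b\neq\emptyset}\phi(b,\underline t)<0=\phi(\emptyset,\underline t)$; and $v(b,\bar t)>0$ for all $b\ne\emptyset$. Sold-alone quantity. For $b\ne\emptyset$, $Q(b)=1-F(t_b)\in[0,1]$ where $t_b\in T$ satisfies $\phi(b,t_b)=0$; it is assumed that this zero $t_b$ is unique for each $b\neq\emptyset$, so that $Q$ is well defined. Convention: $Q(\emptyset)=0$. Least-favorite good. Good $i$ is a least-favorite good if $$\{i\}=\operatorname{argmax}_{j}v(b^*\setminus\{j\},\bar t)\quad\text{and}\quad \{i\}=\operatorname{argmin}_{j:\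 b^{root}\cup\{j\}\ne b^{root}}v(b^{root}\cup\{j\},\bar t).$$ Branching condition (for good $i$). There exist $\lambda_1,\lambda_2,\mu_1,\mu_2$ such that $$\phi(b^{root}\cup\{i\},\bar t)=\lambda_1\phi(b^*,\bar t)+(1-\lambda_1)\phi(b^{root},\bar t),\quad \phi(b^*\setminus\{i\},\bar t)=\lambda_2\phi(b^*,\bar t)+(1-\lambda_2)\phi(b^{root},\bar t),$$ $$\phi(b^{root}\cup\{i\},\underline t)=\mu_1\phi(b^*,\underline t)+(1-\mu_1)\phi(b^{root},\underline t),\quad \phi(b^*\setminus\{i\},\underline t)=\mu_2\phi(b^*,\underline t)+(1-\mu_2)\phi(b^{root},\underline t),$$ with $\mu_k,\lambda_k\in(0,1)$ for $k\in\{1,2\}$, $\lambda_1<\lambda_2$, and $$\frac{\mu_1}{\lambda_1}<\frac{\mu_2-\mu_1}{\lambda_2-\lambda_1}<\frac{1-\mu_2}{1-\lambda_2}.$$ Moreover, for every $\tilde b$ with $b^{root}\subsetneq\tilde b\subsetneq b^*$ and $\tilde b\notin\{b^{root}\cup\{i\},b^*\setminus\{i\}\}$, there exist $\lambda^{\tilde b},\mu^{\tilde b}$ with $\phi(\tilde b,\bar t)=\lambda^{\tilde b}\phi(b^*,\bar t)+(1-\lambda^{\tilde b})\phi(b^{root},\bar t)$, $\phi(\tilde b,\underline t)=\mu^{\tilde b}\phi(b^*,\underline t)+(1-\mu^{\tilde b})\phi(b^{root},\underline t)$, and $$(\lambda^{\tilde b},\mu^{\tilde b})\in\Big\{(x,y)\in\mathbb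 R^2:\ y>\tfrac{\mu_1}{\lambda_1}x;\ y>\tfrac{1-\mu_2}{1-\lambda_2}x+\tfrac{\mu_2-\lambda_2}{1-\lambda_2};\ x\ge\lambda_1;\ y\le\mu_2\Big\}.$$ Terminology. A function $g:T\to\mathbb R$ is single-crossing in $t$ if $\operatorname{sign}[g(t)]\in\{-1,0,1\}$ is a monotonic function of $t$ (either weakly increasing or weakly decreasing). "Monotonic" means weakly increasing or weakly decreasing on $T$. Monopolist's problem. A mechanism is a measurable map $(a,p):T\to\Delta(\mathcal B)\times\mathbb R$. It is IC if $v(a(t),t)-p(t)\ge v(a(t'),t)-p(t')$ for all $t,t'\in T$, and IR if $v(a(t),t)-p(t)\ge 0$ for all $t\in T$. The monopolist maximizes $\mathbb E[p(t)]$ over IC and IR mechanisms. A menu $B\subseteq\mathcal B$ is optimal if there is an optimal mechanism $(a,p)$ with $a(t)\in B$ for all $t$; an optimal menu $B$ is a minimal optimal menu if no $B'\subsetneq B$ is optimal. (Under (A1) and (A2) the minimal optimal menu is unique.) A menu $\{b_1,\dots,b_m\}$ is a tree menu if (1) there is $i$ with $b_i\ne\emptyset$ and $b_i\subseteq b_j$ for every $b_j\neq\emptyset$ in the menu, and (2) there are $k,l$ with $b_k\not\subseteq b_l$ and $b_l\not\subseteq b_k$. *)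

theory Defs
  imports "HOL-Probability.Probability"
begin

text \<open>Only the values of \<open>dens\<close> on \<open>{type_lo..type_hi}\<close>, and those of \<open>val\<close> on subsets of
  \<open>{1..num_goods}\<close> and on \<open>{type_lo..type_hi}\<close>, are ever used.\<close>

record environment =
  num_goods :: nat
  type_lo :: real
  type_hi :: real
  dens :: "real \<Rightarrow> real"
  val :: "nat set \<Rightarrow> real \<Rightarrow> real"

definition goods :: "environment \<Rightarrow> nat set" where
  "goods E = {1..num_goods E}"

definition bundles :: "environment \<Rightarrow> nat set set" where
  "bundles E = Pow (goods E)"

definition lotteries :: "environment \<Rightarrow> nat set pmf set" where
  "lotteries E = {a. set_pmf a \<subseteq> bundles E}"

definition types :: "environment \<Rightarrow> real set" where
  "types E = {type_lo E..type_hi E}"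

text \<open>The type distribution lives on the restricted space, so that a mechanism has to be measurable
  on the type interval only.\<close>

definition type_dist :: "environment \<Rightarrow> real measure" where
  "type_dist E = density (restrict_space lborel (types E)) (\<lambda>t. ennreal (dens E t))"

definition type_cdf :: "environment \<Rightarrow> real \<Rightarrow> real" where
  "type_cdf E t = measure (type_dist E) {s \<in> types E. s \<le> t}"

text \<open>The derivative within the type interval is one-sided at its two endpoints.\<close>

definition val_deriv :: "environment \<Rightarrow> nat set \<Rightarrow> real \<Rightarrow> real" where
  "val_deriv E b t = vector_derivative (val E b) (at t within types E)"

definition virtual_val :: "environment \<Rightarrow> nat set \<Rightarrow> real \<Rightarrow> real" where
  "virtual_val E b t = val E b t - (1 - type_cdf E t) / dens E t * val_deriv E b t"

definition lottery_val :: "environment \<Rightarrow> nat set pmf \<Rightarrow> real \<Rightarrow> real" where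
  "lottery_val E a t = measure_pmf.expectation a (\<lambda>b. val E b t)"

definition lottery_virtual_val :: "environment \<Rightarrow> nat set pmf \<Rightarrow> real \<Rightarrow> real" where
  "lottery_virtual_val E a t = measure_pmf.expectation a (\<lambda>b. virtual_val E b t)"

definition standing_assumptions :: "environment \<Rightarrow> bool" where
  "standing_assumptions E \<longleftrightarrow>
     1 \<le> num_goods E \<and>
     type_lo E < type_hi E \<and>
     continuous_on (types E) (dens E) \<and>
     (\<forall>t\<in>types E. 0 < dens E t) \<and>
     prob_space (type_dist E) \<and>
     (\<forall>b\<in>bundles E. \<exists>D. continuous_on (types E) D \<and>
        (\<forall>t\<in>types E. (val E b has_real_derivative D t) (at t within types E))) \<and>
     (\<forall>t\<in>types E. val E {} t = 0) \<and>
     (\<forall>b\<in>bundles E. \<forall>b'\<in>bundles E. b \<noteq> b' \<longrightarrow> (\<exists>t\<in>types E. virtual_val E b t \<noteq> virtual_val E b' t)) \<and>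
     Max ((\<lambda>b. virtual_val E b (type_lo E)) ` (bundles E - {{}})) < 0 \<and>
     virtual_val E {} (type_lo E) = 0 \<and>
     (\<forall>b\<in>bundles E. b \<noteq> {} \<longrightarrow> 0 < val E b (type_hi E)) \<and>
     (\<forall>b\<in>bundles E. b \<noteq> {} \<longrightarrow> (\<exists>!t. t \<in> types E \<and> virtual_val E b t = 0))"

definition sold_alone_quantity :: "environment \<Rightarrow> nat set \<Rightarrow> real" where
  "sold_alone_quantity E b =
     (if b = {} then 0 else 1 - type_cdf E (THE t. t \<in> types E \<and> virtual_val E b t = 0))"

definition monotonic_on :: "real set \<Rightarrow> (real \<Rightarrow> real) \<Rightarrow> bool" where
  "monotonic_on S g \<longleftrightarrow> mono_on S g \<or> antimono_on S g"

definition single_crossing_on :: "real set \<Rightarrow> (real \<Rightarrow> real) \<Rightarrow> bool" where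
  "single_crossing_on S g \<longleftrightarrow> monotonic_on S (\<lambda>t. sgn (g t))"

definition least_favorite_good :: "environment \<Rightarrow> nat set \<Rightarrow> nat \<Rightarrow> bool" where
  "least_favorite_good E r i \<longleftrightarrow>
     {i} = {j. is_arg_max (\<lambda>j. val E (goods E - {j}) (type_hi E)) (\<lambda>j. j \<in> goods E) j} \<and>
     {i} = {j. is_arg_min (\<lambda>j. val E (r \<union> {j}) (type_hi E))
                 (\<lambda>j. j \<in> goods E \<and> r \<union> {j} \<noteq> r) j}"

definition branching_condition :: "environment \<Rightarrow> nat set \<Rightarrow> nat \<Rightarrow> bool" where
  "branching_condition E r i \<longleftrightarrow>
     (\<exists>l1 l2 m1 m2 :: real.
        virtual_val E (r \<union> {i}) (type_hi E)
          = l1 * virtual_val E (goods E) (type_hi E) + (1 - l1) * virtual_val E r (type_hi E) \<and>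
        virtual_val E (goods E - {i}) (type_hi E)
          = l2 * virtual_val E (goods E) (type_hi E) + (1 - l2) * virtual_val E r (type_hi E) \<and>
        virtual_val E (r \<union> {i}) (type_lo E)
          = m1 * virtual_val E (goods E) (type_lo E) + (1 - m1) * virtual_val E r (type_lo E) \<and>
        virtual_val E (goods E - {i}) (type_lo E)
          = m2 * virtual_val E (goods E) (type_lo E) + (1 - m2) * virtual_val E r (type_lo E) \<and>
        l1 \<in> {0<..<1} \<and> l2 \<in> {0<..<1} \<and> m1 \<in> {0<..<1} \<and> m2 \<in> {0<..<1} \<and>
        l1 < l2 \<and>
        m1 / l1 < (m2 - m1) / (l2 - l1) \<and>
        (m2 - m1) / (l2 - l1) < (1 - m2) / (1 - l2) \<and>
        (\<forall>c. r \<subset> c \<and> c \<subset> goods E \<and> c \<notin> {r \<union> {i}, goods E - {i}} \<longrightarrow>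
           (\<exists>lc mc :: real.
              virtual_val E c (type_hi E)
                = lc * virtual_val E (goods E) (type_hi E) + (1 - lc) * virtual_val E r (type_hi E) \<and>
              virtual_val E c (type_lo E)
                = mc * virtual_val E (goods E) (type_lo E) + (1 - mc) * virtual_val E r (type_lo E) \<and>
              (lc, mc) \<in> {(x, y). y > m1 / l1 * x \<and>
                                 y > (1 - m2) / (1 - l2) * x + (m2 - l2) / (1 - l2) \<and>
                                 x \<ge> l1 \<and> y \<le> m2})))"

text \<open>The set of lotteries is a simplex in a finite-dimensional space, so measurability of the
  allocation rule is measurability of each of its coordinates.\<close>

definition mechanism :: "environment \<Rightarrow> (real \<Rightarrow> nat set pmf) \<Rightarrow> (real \<Rightarrow> real) \<Rightarrow> bool" where
  "mechanism E a p \<longleftrightarrow>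
     (\<forall>t\<in>types E. a t \<in> lotteries E) \<and>
     (\<forall>b\<in>bundles E. (\<lambda>t. pmf (a t) b) \<in> borel_measurable (restrict_space borel (types E))) \<and>
     p \<in> borel_measurable (restrict_space borel (types E))"

definition IC :: "environment \<Rightarrow> (real \<Rightarrow> nat set pmf) \<Rightarrow> (real \<Rightarrow> real) \<Rightarrow> bool" where
  "IC E a p \<longleftrightarrow>
     (\<forall>t\<in>types E. \<forall>t'\<in>types E. lottery_val E (a t) t - p t \<ge> lottery_val E (a t') t - p t')"

definition IR :: "environment \<Rightarrow> (real \<Rightarrow> nat set pmf) \<Rightarrow> (real \<Rightarrow> real) \<Rightarrow> bool" where
  "IR E a p \<longleftrightarrow> (\<forall>t\<in>types E. lottery_val E (a t) t - p t \<ge> 0)"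

definition feasible :: "environment \<Rightarrow> (real \<Rightarrow> nat set pmf) \<Rightarrow> (real \<Rightarrow> real) \<Rightarrow> bool" where
  "feasible E a p \<longleftrightarrow> mechanism E a p \<and> IC E a p \<and> IR E a p"

text \<open>In a feasible mechanism the payment is bounded (compare any two types by IC, and use IR), so
  the integral below is never the default value of a non-integrable function.\<close>

definition revenue :: "environment \<Rightarrow> (real \<Rightarrow> real) \<Rightarrow> real" where
  "revenue E p = (\<integral>t. p t \<partial>type_dist E)"

definition optimal_mechanism :: "environment \<Rightarrow> (real \<Rightarrow> nat set pmf) \<Rightarrow> (real \<Rightarrow> real) \<Rightarrow> bool" where
  "optimal_mechanism E a p \<longleftrightarrow>
     feasible E a p \<and> (\<forall>a' p'. feasible E a' p' \<longrightarrow> revenue E p' \<le> revenue E p)"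

definition optimal_menu :: "environment \<Rightarrow> nat set set \<Rightarrow> bool" where
  "optimal_menu E B \<longleftrightarrow>
     B \<subseteq> bundles E \<and>
     (\<exists>a p. optimal_mechanism E a p \<and> (\<forall>t\<in>types E. a t \<in> return_pmf ` B))"

definition minimal_optimal_menu :: "environment \<Rightarrow> nat set set \<Rightarrow> bool" where
  "minimal_optimal_menu E B \<longleftrightarrow> optimal_menu E B \<and> (\<forall>B'. B' \<subset> B \<longrightarrow> \<not> optimal_menu E B')"

definition tree_menu :: "nat set set \<Rightarrow> bool" where
  "tree_menu B \<longleftrightarrow>
     (\<exists>b\<in>B. b \<noteq> {} \<and> (\<forall>c\<in>B. c \<noteq> {} \<longrightarrow> b \<subseteq> c)) \<and>
     (\<exists>b\<in>B. \<exists>c\<in>B. \<not> b \<subseteq> c \<and> \<not> c \<subseteq> b)"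

end

theory Submission
  imports Defs
begin

text \<open>By the envelope formula the revenue of an IC mechanism is the expected virtual value of its
  allocation minus the rent of the lowest type, and by (A1) the pointwise maximiser of the virtual
  value is implementable.  Hence a menu is optimal iff it contains every bundle that is the unique
  maximiser for some type, and these bundles form the unique minimal optimal menu.

  By (A2) every linear combination of virtual values is single-crossing, so a combination vanishing
  at both ends of the type interval vanishes identically: virtual values live in a plane, with
  coordinates their values at the two ends, and as the type grows the maximised linear functional
  sweeps all directions of the closed positive quadrant.  The unique maximisers are therefore the
  vertices of a planar hull.  The branching condition puts the root, the two branches and the grand
  bundle on a strictly convex chain, with all other bundles containing the root strictly on the inner
  side of the lines through its first and last edges; (R1) and (R2) keep every nonempty bundle not
  containing the root off the hull.\<close>

subsection \<open>Integral bounds from one-sided slopes\<close>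

text \<open>Since allocations are merely measurable, the rent of an IC mechanism is Lipschitz but
  need not be differentiable at a given type. The envelope formula is obtained without
  almost-everywhere differentiation: letting a nearby higher (lower) type imitate the given one
  bounds the increments of the rent from below (above) by those of the value of a fixed lottery,
  with an error uniform in the type, and averaging such increments over all types gives each
  inequality.

  The second obstacle is ties: single crossing allows two virtual values to coincide on an interval.
  A fixed ranking breaks ties for implementation; a slight turn of the functional breaks them for
  uniqueness. The turn yields an essential bundle among the best ones of every type, so the
  essential bundles suffice as a menu; each is indispensable because it is strictly best on a whole
  interval. Likewise a branch is exposed by starting from the normal of the first or last side of
  the chain, where it ties with the root or the grand bundle only, and turning away from that
  bundle.\<close>

lemma continuous_on_Icc_bounded:
  fixes f :: "real \<Rightarrow> real"
  assumes "continuous_on {a..b} f"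
  obtains C where "0 < C" "\<And>t. t \<in> {a..b} \<Longrightarrow> \<bar>f t\<bar> \<le> C"
  using compact_imp_bounded[OF compact_continuous_image[OF assms compact_Icc]]
  unfolding bounded_pos by auto

text \<open>Integrating the slope bound for a fixed step \<open>h\<close> over all left ends makes
  the increments of \<open>U\<close> telescope to two integrals of \<open>U\<close> over strips of
  width \<open>h\<close> at the ends, which are close to \<open>h * U b\<close> and
  \<open>h * U a\<close>. No derivative of \<open>U\<close> occurs. The bound \<open>K\<close> pays
  for the strip that the left ends miss.\<close>

lemma integral_le_of_slope:
  fixes U g :: "real \<Rightarrow> real"
  assumes ab: "a < b" and U: "continuous_on {a..b} U"
    and g: "g integrable_on {a..b}" and K: "\<And>t. t \<in> {a..b} \<Longrightarrow> \<bar>g t\<bar> \<le> K"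
    and slope: "\<And>e. 0 < e \<Longrightarrow>
      \<exists>d>0. \<forall>t h. 0 < h \<longrightarrow> h < d \<longrightarrow> a \<le> t \<longrightarrow> t + h \<le> b \<longrightarrow> h * (g t - e) \<le> U (t + h) - U t"
  shows "integral {a..b} g \<le> U b - U a"
proof -
  have Ui: "U integrable_on {x..y}" if "a \<le> x" "y \<le> b" for x y
    using that by (intro integrable_continuous_real continuous_on_subset[OF U]) auto
  have gi: "g integrable_on {x..y}" if "a \<le> x" "y \<le> b" for x y
    using that by (intro integrable_on_subinterval[OF g]) auto
  \<comment> \<open>The error collects \<open>2 * e\<close> from the two end strips of
    \<open>U\<close>, \<open>e\<close> from the last strip of \<open>g\<close>, and
    \<open>(b - a) * e\<close> from the slope tolerance.\<close>
  have main: "integral {a..b} g \<le> U b - U a + e * (3 + (b - a))" if e: "0 < e" for e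
  proof -
    obtain d1 where d1: "0 < d1"
      "\<And>t h. 0 < h \<Longrightarrow> h < d1 \<Longrightarrow> a \<le> t \<Longrightarrow> t + h \<le> b \<Longrightarrow> h * (g t - e) \<le> U (t + h) - U t"
      using slope[OF e] by blast
    have "uniformly_continuous_on {a..b} U"
      using U by (simp add: compact_uniformly_continuous)
    then obtain d2 where d2: "0 < d2"
      "\<And>x y. x \<in> {a..b} \<Longrightarrow> y \<in> {a..b} \<Longrightarrow> dist y x < d2 \<Longrightarrow> dist (U y) (U x) < e"
      unfolding uniformly_continuous_on_def using e by meson
    have "0 < Min {d1, d2, b - a, e / (\<bar>K\<bar> + 1)}"
      using d1 d2 ab e by (simp add: add_nonneg_pos)
    then obtain h where "0 < h" "h < Min {d1, d2, b - a, e / (\<bar>K\<bar> + 1)}"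
      using dense by blast
    then have h: "0 < h" "h < d1" "h < d2" "h < b - a" "h < e / (\<bar>K\<bar> + 1)" by simp_all
    have hK: "h * K \<le> e"
    proof -
      have "h * K \<le> h * (\<bar>K\<bar> + 1)" using h(1) by (intro mult_left_mono) auto
      also have "\<dots> \<le> e" using h(5) by (simp add: pos_less_divide_eq add_nonneg_pos)
      finally show ?thesis .
    qed
    have sh: "(\<lambda>z. U (z + h)) integrable_on {a..b - h}"
    proof (intro integrable_continuous_real continuous_on_compose2[OF U])
      show "continuous_on {a..b - h} (\<lambda>z. z + h)" by (intro continuous_intros)
    qed (use h in auto)
    have "integral {a..b - h} (\<lambda>z. h * (g z - e)) \<le> integral {a..b - h} (\<lambda>z. U (z + h) - U z)"
    proof (rule integral_le)
      show "(\<lambda>z. h * (g z - e)) integrable_on {a..b - h}"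
        using integrable_on_mult_right[OF integrable_diff[OF gi[of a "b - h"] integrable_const_ivl]] h
        by auto
      show "(\<lambda>z. U (z + h) - U z) integrable_on {a..b - h}"
        using sh Ui[of a "b - h"] h by (intro integrable_diff) auto
    qed (use d1 h in auto)
    also have "\<dots> = integral {a + h..b} U - integral {a..b - h} U"
      using sh Ui[of a "b - h"] h integral_shift_real_ivl[of "a + h" h b U]
      by (simp add: Henstock_Kurzweil_Integration.integral_diff)
    finally have "integral {a..b - h} (\<lambda>z. h * (g z - e))
        \<le> integral {a + h..b} U - integral {a..b - h} U" .
    moreover have "\<dots> = integral {b - h..b} U - integral {a..a + h} U"
      using Henstock_Kurzweil_Integration.integral_combine[of a "a + h" b U]
        Henstock_Kurzweil_Integration.integral_combine[of a "b - h" b U] h Ui[of a b] by simp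
    moreover have "integral {b - h..b} U \<le> integral {b - h..b} (\<lambda>z. U b + e)"
    proof (rule integral_le)
      fix x assume "x \<in> {b - h..b}"
      then show "U x \<le> U b + e" using d2(2)[of b x] h ab by (auto simp: dist_real_def)
    qed (use Ui[of "b - h" b] h in auto)
    moreover have "integral {a..a + h} U \<ge> integral {a..a + h} (\<lambda>z. U a - e)"
    proof (rule integral_le)
      fix x assume "x \<in> {a..a + h}"
      then show "U a - e \<le> U x" using d2(2)[of a x] h ab by (auto simp: dist_real_def)
    qed (use Ui[of a "a + h"] h in auto)
    ultimately have "integral {a..b - h} (\<lambda>z. h * (g z - e)) \<le> h * (U b - U a + 2 * e)"
      using h by (simp add: algebra_simps)
    moreover have "integral {a..b - h} (\<lambda>z. h * (g z - e))
        = h * (integral {a..b - h} g - (b - h - a) * e)"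
      using Henstock_Kurzweil_Integration.integral_diff[OF gi[of a "b - h"] integrable_const_ivl] h
      by simp
    ultimately have 1: "integral {a..b - h} g - (b - h - a) * e \<le> U b - U a + 2 * e"
      using h(1) by simp
    have "integral {b - h..b} g \<le> integral {b - h..b} (\<lambda>z. K)"
    proof (rule integral_le)
      fix x assume "x \<in> {b - h..b}"
      then have "x \<in> {a..b}" using h by auto
      from K[OF this] show "g x \<le> K" by auto
    qed (use gi[of "b - h" b] h in auto)
    then have 2: "integral {b - h..b} g \<le> e" using h hK by simp
    have "integral {a..b} g = integral {a..b - h} g + integral {b - h..b} g"
      using Henstock_Kurzweil_Integration.integral_combine[of a "b - h" b g] h g by simp
    moreover have "(b - h - a) * e \<le> (b - a) * e" using h e by simp
    ultimately show ?thesis using 1 2 by (simp add: algebra_simps)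
  qed
  show ?thesis
  proof (rule field_le_epsilon)
    fix e :: real assume "0 < e"
    then have "0 < e / (3 + (b - a))" using ab by simp
    from main[OF this] show "integral {a..b} g \<le> U b - U a + e" using ab by simp
  qed
qed

text \<open>The product \<open>w * U\<close> plus the indefinite integral of \<open>f * U\<close> has slopes at least \<open>w * g\<close>, so
  this is integration by parts although neither \<open>U\<close> nor the integral of \<open>g\<close> need be differentiable.\<close>

lemma weighted_integral_le_of_slope:
  fixes U g w f :: "real \<Rightarrow> real"
  assumes ab: "a < b" and U: "continuous_on {a..b} U" and w: "continuous_on {a..b} w"
    and f: "continuous_on {a..b} f"
    and w01: "\<And>t. t \<in> {a..b} \<Longrightarrow> 0 \<le> w t \<and> w t \<le> 1"
    and wf: "\<And>x y. a \<le> x \<Longrightarrow> x \<le> y \<Longrightarrow> y \<le> b \<Longrightarrow> w y - w x = - integral {x..y} f"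
    and g: "(\<lambda>t. w t * g t) integrable_on {a..b}" and K: "\<And>t. t \<in> {a..b} \<Longrightarrow> \<bar>g t\<bar> \<le> K"
    and slope: "\<And>e. 0 < e \<Longrightarrow>
      \<exists>d>0. \<forall>t h. 0 < h \<longrightarrow> h < d \<longrightarrow> a \<le> t \<longrightarrow> t + h \<le> b \<longrightarrow> h * (g t - e) \<le> U (t + h) - U t"
  shows "integral {a..b} (\<lambda>t. w t * g t) \<le> w b * U b - w a * U a + integral {a..b} (\<lambda>t. f t * U t)"
proof -
  define V where "V t = w t * U t + integral {a..t} (\<lambda>t. f t * U t)" for t
  have fU: "continuous_on {a..b} (\<lambda>t. f t * U t)" using f U by (intro continuous_intros)
  have fUi: "(\<lambda>t. f t * U t) integrable_on {x..y}" if "a \<le> x" "y \<le> b" for x y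
    using that by (intro integrable_continuous_real continuous_on_subset[OF fU]) auto
  have fi: "f integrable_on {x..y}" if "a \<le> x" "y \<le> b" for x y
    using that by (intro integrable_continuous_real continuous_on_subset[OF f]) auto
  obtain F where F: "0 < F" "\<And>t. t \<in> {a..b} \<Longrightarrow> \<bar>f t\<bar> \<le> F"
    using continuous_on_Icc_bounded[OF f] by blast
  have "integral {a..b} (\<lambda>t. w t * g t) \<le> V b - V a"
  proof (rule integral_le_of_slope[OF ab _ g])
    show "continuous_on {a..b} V"
      unfolding V_def using w U fUi[of a b]
      by (intro continuous_intros indefinite_integral_continuous_1) auto
    show "\<bar>w t * g t\<bar> \<le> K" if "t \<in> {a..b}" for t
      using mult_mono[of "\<bar>w t\<bar>" 1 "\<bar>g t\<bar>" K] w01[OF that] K[OF that] by (simp add: abs_mult)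
    fix e :: real assume e: "0 < e"
    obtain d1 where d1: "0 < d1"
      "\<And>t h. 0 < h \<Longrightarrow> h < d1 \<Longrightarrow> a \<le> t \<Longrightarrow> t + h \<le> b \<Longrightarrow> h * (g t - e / 2) \<le> U (t + h) - U t"
      using slope[of "e / 2"] e by auto
    have "uniformly_continuous_on {a..b} U"
      using U by (simp add: compact_uniformly_continuous)
    \<comment> \<open>\<open>F\<close> bounds \<open>f\<close>, so this tolerance keeps
      \<open>f z * (U z - U (t + h))\<close> within \<open>e / 2\<close>. The other half of
      \<open>e\<close> is the slope tolerance, which the weight \<open>w\<close>, being at most 1,
      does not enlarge.\<close>
    moreover have "0 < e / (2 * F)" using e F by simp
    ultimately obtain d2 where d2: "0 < d2"
      "\<And>x y. x \<in> {a..b} \<Longrightarrow> y \<in> {a..b} \<Longrightarrow> dist y x < d2 \<Longrightarrow> dist (U y) (U x) < e / (2 * F)"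
      unfolding uniformly_continuous_on_def by meson
    have "h * (w t * g t - e) \<le> V (t + h) - V t"
      if h: "0 < h" "h < min d1 d2" and t: "a \<le> t" "t + h \<le> b" for t h
    proof -
      let ?I = "{t..t + h}"
      have fU2: "(\<lambda>z. f z * U (t + h)) integrable_on ?I"
        using fi[of t "t + h"] t by (simp add: integrable_on_mult_left)
      \<comment> \<open>Discrete product rule: the drift of \<open>w\<close> is an integral of
        \<open>f\<close> and merges with the increment of the indefinite integral, leaving only
        differences of \<open>U\<close> within the step.\<close>
      have "V (t + h) - V t
          = w t * (U (t + h) - U t) + (w (t + h) - w t) * U (t + h) + integral ?I (\<lambda>z. f z * U z)"
        using Henstock_Kurzweil_Integration.integral_combine[of a t "t + h" "\<lambda>t. f t * U t"]
          fUi[of a "t + h"] h t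
        by (simp add: V_def algebra_simps)
      also have "(w (t + h) - w t) * U (t + h) = - integral ?I (\<lambda>z. f z * U (t + h))"
        using wf[of t "t + h"] h t by simp
      finally have "V (t + h) - V t = w t * (U (t + h) - U t)
          + integral ?I (\<lambda>z. f z * U z - f z * U (t + h))"
        using fUi[of t "t + h"] fU2 h t by (simp add: Henstock_Kurzweil_Integration.integral_diff)
      moreover have "integral ?I (\<lambda>z. - (e / 2)) \<le> integral ?I (\<lambda>z. f z * U z - f z * U (t + h))"
      proof (rule integral_le)
        show "(\<lambda>z. f z * U z - f z * U (t + h)) integrable_on ?I"
          using fUi[of t "t + h"] fU2 t by (intro integrable_diff) auto
        fix z assume z: "z \<in> ?I"
        then have "\<bar>U z - U (t + h)\<bar> \<le> e / (2 * F)"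
          using d2(2)[of "t + h" z] h t by (auto simp: dist_real_def)
        then have "\<bar>f z\<bar> * \<bar>U z - U (t + h)\<bar> \<le> F * (e / (2 * F))"
          using F z t by (intro mult_mono) auto
        then have "\<bar>f z * (U z - U (t + h))\<bar> \<le> e / 2" using F by (simp add: abs_mult)
        then have "\<bar>f z * U z - f z * U (t + h)\<bar> \<le> e / 2" unfolding right_diff_distrib .
        then show "- (e / 2) \<le> f z * U z - f z * U (t + h)" by linarith
      qed (rule integrable_const_ivl)
      moreover have "w t * (h * (g t - e / 2)) \<le> w t * (U (t + h) - U t)"
        using d1(2)[of h t] w01[of t] h t by (intro mult_left_mono) auto
      moreover have "w t * (h * (e / 2)) \<le> 1 * (h * (e / 2))"
        using w01[of t] h t e by (intro mult_right_mono) auto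
      ultimately show ?thesis using h by (simp add: algebra_simps)
    qed
    then show "\<exists>d>0. \<forall>t h. 0 < h \<longrightarrow> h < d \<longrightarrow> a \<le> t \<longrightarrow> t + h \<le> b
        \<longrightarrow> h * (w t * g t - e) \<le> V (t + h) - V t"
      using d1(1) d2(1) by (intro exI[of _ "min d1 d2"]) auto
  qed
  then show ?thesis by (simp add: V_def)
qed

lemma has_real_derivative_within_nonneg_if_mono_on:
  fixes f :: "real \<Rightarrow> real"
  assumes ab: "a < b" and x: "x \<in> {a..b}"
    and D: "(f has_real_derivative D) (at x within {a..b})" and m: "mono_on {a..b} f"
  shows "0 \<le> D"
proof (rule tendsto_lowerbound)
  show "((\<lambda>y. (f y - f x) / (y - x)) \<longlongrightarrow> D) (at x within {a..b})"
    using D by (simp add: has_field_derivative_iff)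
  show "\<forall>\<^sub>F y in at x within {a..b}. 0 \<le> (f y - f x) / (y - x)"
    unfolding eventually_at_filter
  proof (intro always_eventually allI impI)
    fix y assume "y \<noteq> x" and y: "y \<in> {a..b}"
    then consider "y < x" | "x < y" by linarith
    then show "0 \<le> (f y - f x) / (y - x)"
    proof cases
      case 1
      then have "f y \<le> f x" using mono_onD[OF m y x] by simp
      then show ?thesis using 1 by (simp add: divide_nonpos_neg)
    next
      case 2
      then have "f x \<le> f y" using mono_onD[OF m x y] by simp
      then show ?thesis using 2 by simp
    qed
  qed
  show "at x within {a..b} \<noteq> bot"
    using ab x by (simp add: trivial_limit_within islimpt_Icc)
qed

lemma bounded_measurable_integrable_Icc:
  fixes g :: "real \<Rightarrow> real"
  assumes g: "g \<in> borel_measurable (restrict_space borel {a..b})"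
    and K: "\<And>t. t \<in> {a..b} \<Longrightarrow> \<bar>g t\<bar> \<le> K"
  shows "set_integrable lborel {a..b} g" "g integrable_on {a..b}"
proof -
  have m: "set_borel_measurable borel {a..b} g"
    using g unfolding set_borel_measurable_def
    by (subst (asm) borel_measurable_restrict_space_iff) auto
  show 1: "set_integrable lborel {a..b} g"
    unfolding set_integrable_def
  proof (rule integrableI_bounded_set[where A = "{a..b}" and B = K])
    show "emeasure lborel {a..b} < \<infinity>" by (simp add: emeasure_lborel_Icc_eq)
    show "(\<lambda>x. indicator {a..b} x *\<^sub>R g x) \<in> borel_measurable lborel"
      using m by (simp add: set_borel_measurable_def)
  qed (use K in \<open>auto simp: indicator_def\<close>)
  show "g integrable_on {a..b}" by (rule set_borel_integral_eq_integral(1)[OF 1])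
qed

lemma has_integral_reflect_shift:
  fixes h :: "real \<Rightarrow> real"
  assumes "(h has_integral I) {s - y..s - x}"
  shows "((\<lambda>z. h (s - z)) has_integral I) {x..y}"
  using has_integral_shift_real_ivl[OF has_integral_reflect_lemma_real[OF assms], of "- s"] by simp

lemma integral_reflect_shift:
  fixes h :: "real \<Rightarrow> real"
  assumes "h integrable_on {s - y..s - x}"
  shows "integral {x..y} (\<lambda>z. h (s - z)) = integral {s - y..s - x} h"
  using has_integral_reflect_shift[OF integrable_integral[OF assms]] by (rule integral_unique)

text \<open>Reflecting the interval about its midpoint exchanges left and right ends of the steps.
  Under it \<open>f\<close> and \<open>g\<close> change sign, so
  \<open>weighted_integral_le_of_slope\<close> yields the opposite inequality.\<close>

lemma weighted_integral_ge_of_slope: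
  fixes U g w f :: "real \<Rightarrow> real"
  assumes ab: "a < b" and U: "continuous_on {a..b} U" and w: "continuous_on {a..b} w"
    and f: "continuous_on {a..b} f"
    and w01: "\<And>t. t \<in> {a..b} \<Longrightarrow> 0 \<le> w t \<and> w t \<le> 1"
    and wf: "\<And>x y. a \<le> x \<Longrightarrow> x \<le> y \<Longrightarrow> y \<le> b \<Longrightarrow> w y - w x = - integral {x..y} f"
    and g: "(\<lambda>t. w t * g t) integrable_on {a..b}" and K: "\<And>t. t \<in> {a..b} \<Longrightarrow> \<bar>g t\<bar> \<le> K"
    and slope: "\<And>e. 0 < e \<Longrightarrow>
      \<exists>d>0. \<forall>t h. 0 < h \<longrightarrow> h < d \<longrightarrow> a \<le> t - h \<longrightarrow> t \<le> b \<longrightarrow> U t - U (t - h) \<le> h * (g t + e)"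
  shows "w b * U b - w a * U a + integral {a..b} (\<lambda>t. f t * U t) \<le> integral {a..b} (\<lambda>t. w t * g t)"
proof -
  define s where "s = a + b"
  let ?r = "\<lambda>x. s - x"
  have r: "?r x \<in> {a..b}" if "x \<in> {a..b}" for x using that by (auto simp: s_def)
  have cr: "continuous_on {a..b} (\<lambda>x. h (s - x))" if "continuous_on {a..b} h" for h :: "real \<Rightarrow> real"
    by (rule continuous_on_compose2[OF that]) (use r in \<open>auto intro!: continuous_intros\<close>)
  have sab: "{s - b..s - a} = {a..b}" by (simp add: s_def)
  have fU: "(\<lambda>t. f t * U t) integrable_on {a..b}"
    using f U by (intro integrable_continuous_real continuous_intros)
  have "integral {a..b} (\<lambda>x. w (s - x) * - g (s - x)) \<le> w (s - b) * U (s - b) - w (s - a) * U (s - a)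
      + integral {a..b} (\<lambda>x. - f (s - x) * U (s - x))"
  proof (rule weighted_integral_le_of_slope[OF ab cr[OF U] cr[OF w]])
    show "continuous_on {a..b} (\<lambda>x. - f (s - x))" using cr[OF f] by (rule continuous_on_minus)
    show "0 \<le> w (s - x) \<and> w (s - x) \<le> 1" if "x \<in> {a..b}" for x using w01 r that by blast
    show "w (s - y) - w (s - x) = - integral {x..y} (\<lambda>z. - f (s - z))"
      if "a \<le> x" "x \<le> y" "y \<le> b" for x y
    proof -
      have "f integrable_on {s - y..s - x}"
        by (intro integrable_continuous_real continuous_on_subset[OF f])
          (use that in \<open>auto simp: s_def\<close>)
      then have "integral {x..y} (\<lambda>z. f (s - z)) = integral {s - y..s - x} f"
        by (rule integral_reflect_shift)
      then show ?thesis using wf[of "s - y" "s - x"] that by (simp add: s_def)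
    qed
    show "(\<lambda>x. w (s - x) * - g (s - x)) integrable_on {a..b}"
      using integrable_neg[OF has_integral_integrable[OF has_integral_reflect_shift, of _ _ s b a]]
        integrable_integral[OF g] by (simp add: sab)
    show "\<bar>- g (s - x)\<bar> \<le> K" if "x \<in> {a..b}" for x using K[OF r[OF that]] by simp
    fix e :: real assume "0 < e"
    then obtain d where d: "0 < d"
      "\<And>t h. 0 < h \<Longrightarrow> h < d \<Longrightarrow> a \<le> t - h \<Longrightarrow> t \<le> b \<Longrightarrow> U t - U (t - h) \<le> h * (g t + e)"
      using slope by meson
    have "h * (- g (s - x) - e) \<le> U (s - (x + h)) - U (s - x)"
      if "0 < h" "h < d" "a \<le> x" "x + h \<le> b" for x h
      using d(2)[of h "s - x"] that by (simp add: s_def algebra_simps)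
    then show "\<exists>d>0. \<forall>x h. 0 < h \<longrightarrow> h < d \<longrightarrow> a \<le> x \<longrightarrow> x + h \<le> b \<longrightarrow>
        h * (- g (s - x) - e) \<le> U (s - (x + h)) - U (s - x)"
      using d(1) by blast
  qed
  also have "integral {a..b} (\<lambda>x. w (s - x) * - g (s - x)) = - integral {a..b} (\<lambda>t. w t * g t)"
    using integral_reflect_shift[of "\<lambda>t. w t * g t" s b a] g by (simp add: sab)
  also have "integral {a..b} (\<lambda>x. - f (s - x) * U (s - x)) = - integral {a..b} (\<lambda>t. f t * U t)"
    using integral_reflect_shift[of "\<lambda>t. f t * U t" s b a] fU by (simp add: sab)
  finally show ?thesis by (simp add: s_def)
qed

subsection \<open>Virtual values and the revenue of IC mechanisms\<close>

locale pricing_problem =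
  fixes E :: environment
  assumes standing: "standing_assumptions E"
begin

abbreviation "lo \<equiv> type_lo E"
abbreviation "hi \<equiv> type_hi E"
abbreviation "phi \<equiv> virtual_val E"
abbreviation "F \<equiv> type_cdf E"

lemma types_eq: "types E = {lo..hi}"
  by (simp add: types_def)

lemma lo_less_hi: "lo < hi"
  using standing[unfolded standing_assumptions_def] by (elim conjE)

lemma lo_hi_in_types [simp]: "lo \<in> types E" "hi \<in> types E"
  using lo_less_hi by (simp_all add: types_eq)

lemma types_sets_borel: "types E \<in> sets borel"
  by (simp add: types_eq)

lemma finite_bundles [simp]: "finite (bundles E)"
  by (simp add: bundles_def goods_def)

lemma empty_in_bundles [simp]: "{} \<in> bundles E"
  by (simp add: bundles_def)

lemma goods_in_bundles [simp]: "goods E \<in> bundles E"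
  by (simp add: bundles_def)

section \<open>Consequences of the standing assumptions, and the type distribution\<close>

lemma dens_continuous: "continuous_on (types E) (dens E)"
  and dens_pos: "t \<in> types E \<Longrightarrow> 0 < dens E t"
  and prob_space_type_dist: "prob_space (type_dist E)"
  and val_empty: "t \<in> types E \<Longrightarrow> val E {} t = 0"
proof -
  note conjs = standing[unfolded standing_assumptions_def]
  show "continuous_on (types E) (dens E)" using conjs by (elim conjE)
  show "prob_space (type_dist E)" using conjs by (elim conjE)
  have "\<forall>t\<in>types E. 0 < dens E t" using conjs by (elim conjE)
  then show "t \<in> types E \<Longrightarrow> 0 < dens E t" ..
  have "\<forall>t\<in>types E. val E {} t = 0" using conjs by (elim conjE)
  then show "t \<in> types E \<Longrightarrow> val E {} t = 0" ..
qed

text \<open>\<open>vector_derivative\<close> is a choice operator; derivatives within a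
  nondegenerate interval are unique, even at its endpoints, so it returns the continuous derivative
  provided by the standing assumptions.\<close>

lemma val_deriv:
  assumes "b \<in> bundles E"
  shows "continuous_on (types E) (val_deriv E b)"
    and "t \<in> types E \<Longrightarrow> (val E b has_real_derivative val_deriv E b t) (at t within types E)"
proof -
  obtain D where D: "continuous_on (types E) D"
    "\<And>t. t \<in> types E \<Longrightarrow> (val E b has_real_derivative D t) (at t within types E)"
    using standing[unfolded standing_assumptions_def] assms by (elim conjE) meson
  have eq: "val_deriv E b t = D t" if "t \<in> types E" for t
    unfolding val_deriv_def types_eq
  proof (rule vector_derivative_within_closed_interval[OF lo_less_hi])
    show "t \<in> {lo..hi}" using that by (simp add: types_eq)
    show "(val E b has_vector_derivative D t) (at t within {lo..hi})"
      using D(2)[OF that] by (simp add: types_eq has_real_derivative_iff_has_vector_derivative)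
  qed
  show "continuous_on (types E) (val_deriv E b)"
    by (rule iffD2[OF continuous_on_cong[OF refl eq] D(1)])
  show "t \<in> types E \<Longrightarrow> (val E b has_real_derivative val_deriv E b t) (at t within types E)"
    using D(2) eq by simp
qed

lemma val_continuous: "b \<in> bundles E \<Longrightarrow> continuous_on (types E) (val E b)"
  using val_deriv(2) by (auto intro: DERIV_continuous_on)

text \<open>Passage from the Lebesgue integral against \<open>type_dist\<close> to the gauge
  integral on an interval, in which the slope bounds are phrased.\<close>

lemma revenue_eq_integral:
  assumes p: "p \<in> borel_measurable (restrict_space borel (types E))"
    and K: "\<And>t. t \<in> types E \<Longrightarrow> \<bar>p t\<bar> \<le> K"
  shows "revenue E p = integral (types E) (\<lambda>t. dens E t * p t)"
    and "(\<lambda>t. dens E t * p t) integrable_on types E"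
proof -
  have dm: "dens E \<in> borel_measurable (restrict_space borel (types E))"
    by (rule borel_measurable_continuous_on_restrict[OF dens_continuous])
  have sets_eq: "sets (restrict_space lborel (types E)) = sets (restrict_space borel (types E))"
    by (rule sets_restrict_space_cong) simp
  obtain C where C: "0 < C" "\<And>t. t \<in> types E \<Longrightarrow> \<bar>dens E t\<bar> \<le> C"
    using continuous_on_Icc_bounded[OF dens_continuous[unfolded types_eq]]
    unfolding types_eq by blast
  have "\<bar>dens E t * p t\<bar> \<le> C * K" if "t \<in> types E" for t
    using C K[OF that] that by (simp add: abs_mult mult_mono)
  moreover have "(\<lambda>t. dens E t * p t) \<in> borel_measurable (restrict_space borel (types E))"
    using dm p by (rule borel_measurable_times)
  ultimately have si: "set_integrable lborel (types E) (\<lambda>t. dens E t * p t)"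
    and "(\<lambda>t. dens E t * p t) integrable_on types E"
    using bounded_measurable_integrable_Icc[of "\<lambda>t. dens E t * p t" lo hi "C * K"]
    unfolding types_eq by auto
  then show "(\<lambda>t. dens E t * p t) integrable_on types E" by simp
  have "revenue E p = (\<integral>t. dens E t *\<^sub>R p t \<partial>restrict_space lborel (types E))"
    unfolding revenue_def type_dist_def
  proof (rule integral_density)
    show "p \<in> borel_measurable (restrict_space lborel (types E))"
      using p by (simp cong: measurable_cong_sets add: sets_eq)
    show "dens E \<in> borel_measurable (restrict_space lborel (types E))"
      using dm by (simp cong: measurable_cong_sets add: sets_eq)
    show "AE t in restrict_space lborel (types E). 0 \<le> dens E t"
      using dens_pos by (intro AE_I2) (auto simp: space_restrict_space less_imp_le)
  qed
  also have "\<dots> = (LINT t : types E | lborel. dens E t * p t)"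
    unfolding set_lebesgue_integral_def
    by (subst integral_restrict_space) (simp_all add: types_eq)
  also have "\<dots> = integral (types E) (\<lambda>t. dens E t * p t)"
    by (rule set_borel_integral_eq_integral(2)[OF si])
  finally show "revenue E p = integral (types E) (\<lambda>t. dens E t * p t)" .
qed

lemma dens_integrable: "lo \<le> x \<Longrightarrow> y \<le> hi \<Longrightarrow> dens E integrable_on {x..y}"
  using dens_continuous by (intro integrable_continuous_real continuous_on_subset[OF dens_continuous])
    (auto simp: types_eq)

lemma cdf_eq_integral:
  assumes t: "t \<in> types E"
  shows "F t = integral {lo..t} (dens E)"
proof -
  have sp: "space (type_dist E) = types E"
    by (simp add: type_dist_def space_restrict_space)
  have "F t = measure (type_dist E) ({..t} \<inter> space (type_dist E))"
    unfolding type_cdf_def sp by (rule arg_cong[where f = "measure _"]) auto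
  \<comment> \<open>The distribution function is the revenue from charging 1 to the types up to
    \<open>t\<close>, so the formula for revenue applies.\<close>
  also have "\<dots> = revenue E (indicator {..t})"
    by (simp add: revenue_def)
  also have "\<dots> = integral (types E) (\<lambda>s. dens E s * indicator {..t} s)"
    by (rule revenue_eq_integral(1)[where K = 1])
      (simp_all add: measurable_restrict_space1 borel_measurable_indicator)
  also have "\<dots> = integral (types E) (\<lambda>s. if s \<in> {..t} then dens E s else 0)"
    by (rule arg_cong[where f = "integral _"]) (auto simp: indicator_def)
  also have "\<dots> = integral (types E \<inter> {..t}) (dens E)"
    using Henstock_Kurzweil_Integration.integral_restrict_Int[of "types E" "{..t}" "dens E"]
    by (simp add: Int_commute)
  also have "types E \<inter> {..t} = {lo..t}" using t by (auto simp: types_eq)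
  finally show ?thesis .
qed

lemma cdf_diff:
  assumes "lo \<le> x" "x \<le> y" "y \<le> hi"
  shows "F y - F x = integral {x..y} (dens E)"
  using Henstock_Kurzweil_Integration.integral_combine[of lo x y "dens E"] assms
    dens_integrable[of lo y] cdf_eq_integral[of x] cdf_eq_integral[of y]
  by (simp add: types_eq)

lemma cdf_strict_mono:
  assumes "lo \<le> x" "x < y" "y \<le> hi"
  shows "F x < F y"
proof -
  have "0 < integral {x..y} (dens E)"
  proof -
    have c: "continuous_on {x..y} (dens E)"
      by (rule continuous_on_subset[OF dens_continuous]) (use assms in \<open>auto simp: types_eq\<close>)
    have nn: "\<And>s. s \<in> {x..y} \<Longrightarrow> 0 \<le> dens E s"
      using dens_pos assms by (auto simp: types_eq intro: less_imp_le)
    have "integral {x..y} (dens E) \<noteq> 0"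
      using integral_eq_0_iff[OF c assms(2)] nn dens_pos[of x] assms by (auto simp: types_eq)
    moreover have "0 \<le> integral {x..y} (dens E)"
      using nn dens_integrable[of x y] assms by (intro integral_nonneg) auto
    ultimately show ?thesis by simp
  qed
  then show ?thesis using cdf_diff[of x y] assms by simp
qed

lemma cdf_lo: "F lo = 0"
  by (simp add: cdf_eq_integral)

lemma cdf_hi: "F hi = 1"
proof -
  have "F hi = measure (type_dist E) (space (type_dist E))"
    unfolding type_cdf_def
    by (rule arg_cong[where f = "measure _"]) (auto simp: type_dist_def space_restrict_space types_eq)
  then show ?thesis using prob_space.prob_space[OF prob_space_type_dist] by simp
qed

lemma cdf_bounds: "t \<in> types E \<Longrightarrow> 0 \<le> F t \<and> F t \<le> 1"
  using cdf_strict_mono[of lo t] cdf_strict_mono[of t hi] cdf_lo cdf_hi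
  by (cases "t = lo"; cases "t = hi") (auto simp: types_eq)

lemma cdf_continuous: "continuous_on (types E) F"
proof -
  have "continuous_on (types E) (\<lambda>t. integral {lo..t} (dens E))"
    unfolding types_eq by (rule indefinite_integral_continuous_1[OF dens_integrable]) auto
  moreover have "continuous_on (types E) F
      = continuous_on (types E) (\<lambda>t. integral {lo..t} (dens E))"
    by (rule continuous_on_cong[OF refl cdf_eq_integral])
  ultimately show ?thesis by simp
qed

lemma phi_continuous: "b \<in> bundles E \<Longrightarrow> continuous_on (types E) (phi b)"
  unfolding virtual_val_def
  using val_continuous val_deriv(1) cdf_continuous dens_continuous less_imp_neq[OF dens_pos]
  by (intro continuous_intros) auto

lemma phi_hi: "phi b hi = val E b hi"
  by (simp add: virtual_val_def cdf_hi)

text \<open>The standing assumptions fix \<open>phi {}\<close> only at \<open>lo\<close>. Elsewhere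
  it vanishes because the value of the empty bundle is constant on the type interval, which is all
  that the derivative within it sees.\<close>

lemma phi_empty:
  assumes t: "t \<in> types E"
  shows "phi {} t = 0"
proof -
  have "((\<lambda>t. 0) has_real_derivative 0) (at t within types E)" by simp
  then have "(val E {} has_real_derivative 0) (at t within types E)"
    by (rule has_field_derivative_transform_within[OF _ zero_less_one t]) (simp add: val_empty)
  then have "val_deriv E {} t = 0"
    unfolding val_deriv_def types_eq
  proof (intro vector_derivative_within_closed_interval[OF lo_less_hi])
    show "t \<in> {lo..hi}" using t by (simp add: types_eq)
  qed (simp add: types_eq has_real_derivative_iff_has_vector_derivative)
  then show ?thesis using t by (simp add: virtual_val_def val_empty)
qed

lemma expectation_eq_sum:
  fixes g :: "nat set \<Rightarrow> real"
  assumes "a \<in> lotteries E"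
  shows "measure_pmf.expectation a g = (\<Sum>b\<in>bundles E. pmf a b * g b)"
  using assms by (subst integral_measure_pmf[of "bundles E"]) (auto simp: lotteries_def)

lemma sum_pmf_bundles: "a \<in> lotteries E \<Longrightarrow> (\<Sum>b\<in>bundles E. pmf a b) = 1"
  by (rule sum_pmf_eq_1) (auto simp: lotteries_def)

lemma return_in_lotteries: "b \<in> bundles E \<Longrightarrow> return_pmf b \<in> lotteries E"
  by (simp add: lotteries_def)

section \<open>Signs of virtual values and their zeros\<close>

lemma phi_neg_lo: "b \<in> bundles E \<Longrightarrow> b \<noteq> {} \<Longrightarrow> phi b lo < 0"
proof -
  assume b: "b \<in> bundles E" "b \<noteq> {}"
  have "Max ((\<lambda>b. phi b lo) ` (bundles E - {{}})) < 0"
    using standing[unfolded standing_assumptions_def] by (elim conjE)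
  then show "phi b lo < 0" using b by (subst (asm) Max_less_iff) auto
qed

lemma phi_pos_hi: "b \<in> bundles E \<Longrightarrow> b \<noteq> {} \<Longrightarrow> 0 < phi b hi"
  using standing[unfolded standing_assumptions_def] by (elim conjE) (simp add: phi_hi)

lemma phi_distinct:
  "b \<in> bundles E \<Longrightarrow> c \<in> bundles E \<Longrightarrow> b \<noteq> c \<Longrightarrow> \<exists>t\<in>types E. phi b t \<noteq> phi c t"
  using standing[unfolded standing_assumptions_def] by (elim conjE) simp

text \<open>The threshold behind \<open>sold_alone_quantity\<close>. It is unspecified for the empty
  bundle, whose virtual value vanishes at every type; hence the side conditions
  \<open>b \<noteq> {}\<close> below.\<close>

definition zero_type :: "nat set \<Rightarrow> real" where
  "zero_type b = (THE t. t \<in> types E \<and> phi b t = 0)"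

lemma zero_type:
  assumes "b \<in> bundles E" "b \<noteq> {}"
  shows "zero_type b \<in> types E" "phi b (zero_type b) = 0"
    and zero_type_unique: "t \<in> types E \<Longrightarrow> phi b t = 0 \<Longrightarrow> t = zero_type b"
proof -
  have "\<forall>b\<in>bundles E. b \<noteq> {} \<longrightarrow> (\<exists>!t. t \<in> types E \<and> phi b t = 0)"
    using standing[unfolded standing_assumptions_def] by (elim conjE)
  then have ex1: "\<exists>!t. t \<in> types E \<and> phi b t = 0"
    using assms by blast
  from theI'[OF ex1] show "zero_type b \<in> types E" "phi b (zero_type b) = 0"
    by (simp_all add: zero_type_def)
  then show "t \<in> types E \<Longrightarrow> phi b t = 0 \<Longrightarrow> t = zero_type b" using ex1 by blast
qed

text \<open>The virtual value is negative at \<open>lo\<close>, so a nonnegative value before the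
  zero would by continuity produce a second zero. The next lemma is the mirror image, from the
  positive value at \<open>hi\<close>.\<close>

lemma phi_neg_before_zero_type:
  assumes b: "b \<in> bundles E" "b \<noteq> {}" and t: "t \<in> types E" "t < zero_type b"
  shows "phi b t < 0"
proof (rule ccontr)
  assume "\<not> phi b t < 0"
  moreover have "continuous_on {lo..t} (phi b)"
    by (rule continuous_on_subset[OF phi_continuous[OF b(1)]]) (use t in \<open>auto simp: types_eq\<close>)
  ultimately obtain s where s: "lo \<le> s" "s \<le> t" "phi b s = 0"
    using IVT'[of "phi b" lo 0 t] phi_neg_lo[OF b] t by (auto simp: types_eq)
  then have "s = zero_type b" using zero_type_unique[OF b] t by (auto simp: types_eq)
  then show False using s t by simp
qed

lemma phi_pos_after_zero_type:
  assumes b: "b \<in> bundles E" "b \<noteq> {}" and t: "t \<in> types E" "zero_type b < t"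
  shows "0 < phi b t"
proof (rule ccontr)
  assume "\<not> 0 < phi b t"
  moreover have "continuous_on {t..hi} (phi b)"
    by (rule continuous_on_subset[OF phi_continuous[OF b(1)]]) (use t in \<open>auto simp: types_eq\<close>)
  ultimately obtain s where s: "t \<le> s" "s \<le> hi" "phi b s = 0"
    using IVT'[of "phi b" t 0 hi] phi_pos_hi[OF b] t by (auto simp: types_eq)
  then have "s = zero_type b" using zero_type_unique[OF b] t by (auto simp: types_eq)
  then show False using s t by simp
qed

section \<open>Estimates uniform over bundles and lotteries\<close>

lemma val_deriv_bounded:
  obtains K where "\<And>b t. b \<in> bundles E \<Longrightarrow> t \<in> types E \<Longrightarrow> \<bar>val_deriv E b t\<bar> \<le> K"
proof -
  \<comment> \<open>As eventual statements at infinity, the bounds of finitely many bundles combine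
    into one.\<close>
  have "\<forall>b\<in>bundles E. \<forall>\<^sub>F K in at_top. \<forall>t\<in>types E. \<bar>val_deriv E b t\<bar> \<le> K"
  proof
    fix b assume b: "b \<in> bundles E"
    obtain C where "\<And>t. t \<in> types E \<Longrightarrow> \<bar>val_deriv E b t\<bar> \<le> C"
      using continuous_on_Icc_bounded[OF val_deriv(1)[OF b, unfolded types_eq]]
      unfolding types_eq by blast
    then show "\<forall>\<^sub>F K in at_top. \<forall>t\<in>types E. \<bar>val_deriv E b t\<bar> \<le> K"
      by (intro eventually_mono[OF eventually_ge_at_top[of C]] ballI) (blast intro: order_trans)
  qed
  then have "\<forall>\<^sub>F K in at_top. \<forall>b\<in>bundles E. \<forall>t\<in>types E. \<bar>val_deriv E b t\<bar> \<le> K"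
    by (rule eventually_ball_finite[OF finite_bundles])
  then obtain K where "\<forall>b\<in>bundles E. \<forall>t\<in>types E. \<bar>val_deriv E b t\<bar> \<le> K"
    using eventually_happens'[OF trivial_limit_at_top_linorder] by blast
  then show ?thesis using that by blast
qed

lemma val_lipschitz:
  obtains K where "\<And>b s t. b \<in> bundles E \<Longrightarrow> s \<in> types E \<Longrightarrow> t \<in> types E \<Longrightarrow>
    \<bar>val E b s - val E b t\<bar> \<le> K * \<bar>s - t\<bar>"
proof -
  obtain K where K: "\<And>b t. b \<in> bundles E \<Longrightarrow> t \<in> types E \<Longrightarrow> \<bar>val_deriv E b t\<bar> \<le> K"
    using val_deriv_bounded by blast
  show ?thesis
  proof (rule that)
    fix b s t assume b: "b \<in> bundles E" and "s \<in> types E" "t \<in> types E"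
    then show "\<bar>val E b s - val E b t\<bar> \<le> K * \<bar>s - t\<bar>"
      using field_differentiable_bound[of "types E" "val E b" "val_deriv E b" K s t]
        val_deriv(2)[OF b] K[OF b] by (simp add: types_eq)
  qed
qed

text \<open>The radius \<open>d\<close> must depend neither on the type nor on the bundle, since the
  allocation of a mechanism varies with the type. Uniform continuity of the derivatives handles the
  types, finiteness the bundles.\<close>

lemma val_uniformly_differentiable:
  assumes e: "0 < e"
  obtains d where "0 < d"
    "\<And>b x y. b \<in> bundles E \<Longrightarrow> x \<in> types E \<Longrightarrow> y \<in> types E \<Longrightarrow> \<bar>y - x\<bar> < d \<Longrightarrow>
      \<bar>val E b y - val E b x - (y - x) * val_deriv E b x\<bar> \<le> e * \<bar>y - x\<bar>"
proof -
  let ?P = "\<lambda>b d. \<forall>x\<in>types E. \<forall>y\<in>types E. \<bar>y - x\<bar> < d \<longrightarrow>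
    \<bar>val E b y - val E b x - (y - x) * val_deriv E b x\<bar> \<le> e * \<bar>y - x\<bar>"
  have "\<forall>b\<in>bundles E. \<forall>\<^sub>F d in at_right 0. ?P b d"
  proof
    fix b assume b: "b \<in> bundles E"
    have "uniformly_continuous_on (types E) (val_deriv E b)"
      using val_deriv(1)[OF b] by (simp add: compact_uniformly_continuous types_eq)
    then obtain d where d: "0 < d" "\<And>x y. x \<in> types E \<Longrightarrow> y \<in> types E \<Longrightarrow> dist y x < d \<Longrightarrow>
        dist (val_deriv E b y) (val_deriv E b x) < e"
      unfolding uniformly_continuous_on_def using e by meson
    have "?P b d"
    proof (intro ballI impI)
      fix x y assume x: "x \<in> types E" and y: "y \<in> types E" and xy: "\<bar>y - x\<bar> < d"
      let ?S = "closed_segment x y"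
      have sub: "?S \<subseteq> types E" using x y by (auto simp: types_eq closed_segment_eq_real_ivl)
      have "norm ((val E b y - y * val_deriv E b x) - (val E b x - x * val_deriv E b x))
          \<le> e * norm (y - x)"
      proof (rule field_differentiable_bound[of ?S _ "\<lambda>z. val_deriv E b z - val_deriv E b x"])
        fix z assume z: "z \<in> ?S"
        show "((\<lambda>z. val E b z - z * val_deriv E b x) has_field_derivative
            val_deriv E b z - val_deriv E b x) (at z within ?S)"
          using DERIV_subset[OF val_deriv(2)[OF b] sub] z sub
          by (auto intro!: derivative_eq_intros)
        have "\<bar>z - x\<bar> \<le> \<bar>y - x\<bar>" using z by (auto simp: closed_segment_eq_real_ivl split: if_splits)
        then show "norm (val_deriv E b z - val_deriv E b x) \<le> e"
          using d(2)[of x z] x z sub xy by (auto simp: dist_real_def)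
      qed auto
      then show "\<bar>val E b y - val E b x - (y - x) * val_deriv E b x\<bar> \<le> e * \<bar>y - x\<bar>"
        by (simp add: algebra_simps)
    qed
    then show "\<forall>\<^sub>F d in at_right 0. ?P b d"
      unfolding eventually_at_right_field using d(1) by (intro exI[of _ d]) auto
  qed
  then have "\<forall>\<^sub>F d in at_right 0. \<forall>b\<in>bundles E. ?P b d"
    by (rule eventually_ball_finite[OF finite_bundles])
  then have "\<forall>\<^sub>F d in at_right 0. 0 < d \<and> (\<forall>b\<in>bundles E. ?P b d)"
    using eventually_at_right_less[of "0::real"] by (rule eventually_elim2) simp
  then obtain d where "0 < d" "\<forall>b\<in>bundles E. ?P b d"
    using eventually_happens'[OF trivial_limit_at_right_real] by blast
  then show ?thesis using that by blast
qed

text \<open>The derivative of \<open>lottery_val\<close> in the type with the lottery held fixed, as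
  when one type imitates another.\<close>

definition lottery_deriv :: "nat set pmf \<Rightarrow> real \<Rightarrow> real" where
  "lottery_deriv a t = (\<Sum>b\<in>bundles E. pmf a b * val_deriv E b t)"

lemma lottery_val_eq: "a \<in> lotteries E \<Longrightarrow> lottery_val E a t = (\<Sum>b\<in>bundles E. pmf a b * val E b t)"
  by (simp add: lottery_val_def expectation_eq_sum)

lemma lottery_virtual_val_eq:
  assumes a: "a \<in> lotteries E"
  shows "lottery_virtual_val E a t
    = lottery_val E a t - (1 - F t) / dens E t * lottery_deriv a t"
  using a by (simp add: lottery_virtual_val_def lottery_val_eq lottery_deriv_def expectation_eq_sum
      virtual_val_def right_diff_distrib sum_subtractf sum_distrib_left mult.left_commute)

text \<open>Expectation is a convex combination, so every estimate uniform over bundles passes to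
  lotteries with the same constant.\<close>

lemma abs_lottery_sum_le:
  assumes a: "a \<in> lotteries E" and K: "\<And>b. b \<in> bundles E \<Longrightarrow> \<bar>x b\<bar> \<le> K"
  shows "\<bar>\<Sum>b\<in>bundles E. pmf a b * x b\<bar> \<le> K"
proof -
  have "\<bar>\<Sum>b\<in>bundles E. pmf a b * x b\<bar> \<le> (\<Sum>b\<in>bundles E. \<bar>pmf a b * x b\<bar>)" by (rule sum_abs)
  also have "\<dots> \<le> (\<Sum>b\<in>bundles E. pmf a b * K)"
    using K by (intro sum_mono) (simp add: abs_mult mult_left_mono)
  also have "\<dots> = K" using sum_pmf_bundles[OF a] by (simp flip: sum_distrib_right)
  finally show ?thesis .
qed

lemma lottery_val_lipschitz:
  obtains K where "\<And>a s t. a \<in> lotteries E \<Longrightarrow> s \<in> types E \<Longrightarrow> t \<in> types E \<Longrightarrow>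
    \<bar>lottery_val E a s - lottery_val E a t\<bar> \<le> K * \<bar>s - t\<bar>"
proof -
  obtain K where K: "\<And>b s t. b \<in> bundles E \<Longrightarrow> s \<in> types E \<Longrightarrow> t \<in> types E \<Longrightarrow>
    \<bar>val E b s - val E b t\<bar> \<le> K * \<bar>s - t\<bar>" using val_lipschitz by blast
  have "\<bar>lottery_val E a s - lottery_val E a t\<bar> \<le> K * \<bar>s - t\<bar>"
    if "a \<in> lotteries E" "s \<in> types E" "t \<in> types E" for a s t
    using abs_lottery_sum_le[OF that(1), of "\<lambda>b. val E b s - val E b t" "K * \<bar>s - t\<bar>"] K that
    by (simp add: lottery_val_eq right_diff_distrib sum_subtractf)
  then show ?thesis using that by blast
qed

lemma lottery_val_uniformly_differentiable:
  assumes e: "0 < e"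
  obtains d where "0 < d"
    "\<And>a x y. a \<in> lotteries E \<Longrightarrow> x \<in> types E \<Longrightarrow> y \<in> types E \<Longrightarrow> \<bar>y - x\<bar> < d \<Longrightarrow>
      \<bar>lottery_val E a y - lottery_val E a x - (y - x) * lottery_deriv a x\<bar> \<le> e * \<bar>y - x\<bar>"
proof -
  obtain d where d: "0 < d"
    "\<And>b x y. b \<in> bundles E \<Longrightarrow> x \<in> types E \<Longrightarrow> y \<in> types E \<Longrightarrow> \<bar>y - x\<bar> < d \<Longrightarrow>
      \<bar>val E b y - val E b x - (y - x) * val_deriv E b x\<bar> \<le> e * \<bar>y - x\<bar>"
    using val_uniformly_differentiable[OF e] by blast
  have "\<bar>lottery_val E a y - lottery_val E a x - (y - x) * lottery_deriv a x\<bar> \<le> e * \<bar>y - x\<bar>"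
    if "a \<in> lotteries E" "x \<in> types E" "y \<in> types E" "\<bar>y - x\<bar> < d" for a x y
    using abs_lottery_sum_le[OF that(1),
        of "\<lambda>b. val E b y - val E b x - (y - x) * val_deriv E b x" "e * \<bar>y - x\<bar>"] d(2) that
    by (simp add: lottery_val_eq lottery_deriv_def right_diff_distrib sum_subtractf sum_distrib_left
        mult.left_commute)
  then show ?thesis using that d(1) by blast
qed

lemma lottery_deriv_bounded:
  obtains K where "\<And>a t. a \<in> lotteries E \<Longrightarrow> t \<in> types E \<Longrightarrow> \<bar>lottery_deriv a t\<bar> \<le> K"
  using val_deriv_bounded abs_lottery_sum_le unfolding lottery_deriv_def by metis

lemma measurable_lottery_sum:
  assumes m: "\<And>b. b \<in> bundles E \<Longrightarrow>
      (\<lambda>t. pmf (a t) b) \<in> borel_measurable (restrict_space borel (types E))"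
    and c: "\<And>b. b \<in> bundles E \<Longrightarrow> continuous_on (types E) (x b)"
  shows "(\<lambda>t. \<Sum>b\<in>bundles E. pmf (a t) b * x b t) \<in> borel_measurable (restrict_space borel (types E))"
  using m c by (intro borel_measurable_sum borel_measurable_times)
    (auto intro: borel_measurable_continuous_on_restrict)

text \<open>With rent \<open>U\<close> and marginal value \<open>g\<close>, \<open>dens\<close>
  times the virtual value is \<open>dens * p + dens * U - (1 - F) * g\<close>. The two slope bounds,
  with weight \<open>1 - F\<close> of derivative \<open>- dens\<close>, show that the last two terms
  integrate to \<open>U lo\<close>, because the weight is 1 at \<open>lo\<close> and 0 at
  \<open>hi\<close>.\<close>

theorem IC_revenue:
  assumes m: "mechanism E a p" and ic: "IC E a p"
  shows "revenue E p = integral (types E) (\<lambda>t. dens E t * lottery_virtual_val E (a t) t)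
      - (lottery_val E (a lo) lo - p lo)"
    and "(\<lambda>t. dens E t * lottery_virtual_val E (a t) t) integrable_on types E"
proof -
  define U where "U t = lottery_val E (a t) t - p t" for t
  define g where "g t = lottery_deriv (a t) t" for t
  define w where "w t = 1 - F t" for t
  have al: "a t \<in> lotteries E" if "t \<in> types E" for t using m that by (simp add: mechanism_def)
  have am: "(\<lambda>t. pmf (a t) b) \<in> borel_measurable (restrict_space borel (types E))"
    if "b \<in> bundles E" for b using m that by (simp add: mechanism_def)
  have ic': "lottery_val E (a s) t - lottery_val E (a s) s \<le> U t - U s"
    if "s \<in> types E" "t \<in> types E" for s t
    using ic that unfolding IC_def U_def by (simp add: algebra_simps)
  obtain L where L: "\<And>a s t. a \<in> lotteries E \<Longrightarrow> s \<in> types E \<Longrightarrow> t \<in> types E \<Longrightarrow>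
    \<bar>lottery_val E a s - lottery_val E a t\<bar> \<le> L * \<bar>s - t\<bar>" using lottery_val_lipschitz by blast
  have UL: "\<bar>U t - U s\<bar> \<le> L * \<bar>t - s\<bar>" if "s \<in> types E" "t \<in> types E" for s t
    using ic'[OF that] ic'[OF that(2,1)] L[OF al[OF that(1)] that(2,1)] L[OF al[OF that(2)] that]
    by (auto simp: abs_minus_commute abs_le_iff)
  have "L-lipschitz_on (types E) U"
  proof (rule lipschitz_onI)
    show "0 \<le> L" using UL[of lo hi] lo_less_hi
      by (smt (verit) lo_hi_in_types mult_neg_pos)
  qed (use UL in \<open>simp add: dist_real_def\<close>)
  then have Uc: "continuous_on {lo..hi} U" using lipschitz_on_continuous_on types_eq by metis
  then obtain C where C: "\<And>t. t \<in> types E \<Longrightarrow> \<bar>U t\<bar> \<le> C"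
    using continuous_on_Icc_bounded[OF Uc] unfolding types_eq by blast
  \<comment> \<open>Bounded values and rents bound the payment, as
    \<open>revenue_eq_integral\<close> requires.\<close>
  have val_bd: "\<exists>K. \<forall>t\<in>types E. \<bar>lottery_val E (a t) t\<bar> \<le> K"
  proof (intro exI ballI)
    fix t assume t: "t \<in> types E"
    have 0: "lottery_val E (a t) lo = (\<Sum>b\<in>bundles E. pmf (a t) b * val E b lo)"
      by (rule lottery_val_eq[OF al[OF t]])
    have "\<bar>lottery_val E (a t) lo\<bar> \<le> Max ((\<lambda>b. \<bar>val E b lo\<bar>) ` bundles E)"
      unfolding 0 by (rule abs_lottery_sum_le[OF al[OF t]]) simp
    moreover have "\<bar>lottery_val E (a t) t - lottery_val E (a t) lo\<bar> \<le> \<bar>L\<bar> * (hi - lo)"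
      by (rule order_trans[OF L[OF al[OF t] t lo_hi_in_types(1)]])
        (use t in \<open>auto simp: types_eq intro!: mult_mono\<close>)
    ultimately show "\<bar>lottery_val E (a t) t\<bar> \<le> Max ((\<lambda>b. \<bar>val E b lo\<bar>) ` bundles E) + \<bar>L\<bar> * (hi - lo)"
      by linarith
  qed
  then obtain V where V: "\<And>t. t \<in> types E \<Longrightarrow> \<bar>lottery_val E (a t) t\<bar> \<le> V" by blast
  have pK: "\<bar>p t\<bar> \<le> V + C" if "t \<in> types E" for t
    using V[OF that] C[OF that] unfolding U_def by linarith
  have pm: "p \<in> borel_measurable (restrict_space borel (types E))"
    using m by (simp add: mechanism_def)
  note rev = revenue_eq_integral[OF pm pK]
  obtain K where K: "\<And>a t. a \<in> lotteries E \<Longrightarrow> t \<in> types E \<Longrightarrow> \<bar>lottery_deriv a t\<bar> \<le> K"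
    using lottery_deriv_bounded by blast
  have wc: "continuous_on {lo..hi} w"
    using cdf_continuous unfolding w_def types_eq by (intro continuous_intros)
  have w01: "0 \<le> w t \<and> w t \<le> 1" if "t \<in> {lo..hi}" for t
    using cdf_bounds[of t] that by (auto simp: w_def types_eq)
  have wg: "(\<lambda>t. w t * g t) integrable_on {lo..hi}"
  proof (rule bounded_measurable_integrable_Icc(2))
    show "(\<lambda>t. w t * g t) \<in> borel_measurable (restrict_space borel {lo..hi})"
      using measurable_lottery_sum[OF am val_deriv(1)]
      unfolding g_def lottery_deriv_def types_eq
      by (intro borel_measurable_times borel_measurable_continuous_on_restrict[OF wc])
    show "\<bar>w t * g t\<bar> \<le> 1 * K" if "t \<in> {lo..hi}" for t
      unfolding abs_mult g_def using w01[OF that] K[OF al, of t t] that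
      by (intro mult_mono) (auto simp: types_eq)
  qed
  have dc: "continuous_on {lo..hi} (dens E)" using dens_continuous by (simp add: types_eq)
  have wf: "w y - w x = - integral {x..y} (dens E)" if "lo \<le> x" "x \<le> y" "y \<le> hi" for x y
    using cdf_diff[OF that] by (simp add: w_def)
  have gK: "\<bar>g t\<bar> \<le> K" if "t \<in> {lo..hi}" for t
    using K[OF al, of t t] that by (simp add: g_def types_eq)
  have "integral {lo..hi} (\<lambda>t. w t * g t)
      \<le> w hi * U hi - w lo * U lo + integral {lo..hi} (\<lambda>t. dens E t * U t)"
  proof (rule weighted_integral_le_of_slope[OF lo_less_hi Uc wc dc w01 wf wg gK])
    fix e :: real assume "0 < e"
    then obtain d where d: "0 < d"
      "\<And>a x y. a \<in> lotteries E \<Longrightarrow> x \<in> types E \<Longrightarrow> y \<in> types E \<Longrightarrow> \<bar>y - x\<bar> < d \<Longrightarrow>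
      \<bar>lottery_val E a y - lottery_val E a x - (y - x) * lottery_deriv a x\<bar> \<le> e * \<bar>y - x\<bar>"
      using lottery_val_uniformly_differentiable by blast
    \<comment> \<open>The higher type \<open>t + h\<close> imitates \<open>t\<close>, so
      \<open>g\<close> is evaluated at the left end of the step.\<close>
    have "h * (g t - e) \<le> U (t + h) - U t" if h: "0 < h" "h < d" "lo \<le> t" "t + h \<le> hi" for t h
    proof -
      have t: "t \<in> types E" "t + h \<in> types E" using h by (auto simp: types_eq)
      show ?thesis using d(2)[OF al[OF t(1)] t] ic'[OF t] h
        by (simp add: g_def abs_le_iff algebra_simps)
    qed
    then show "\<exists>d>0. \<forall>t h. 0 < h \<longrightarrow> h < d \<longrightarrow> lo \<le> t \<longrightarrow> t + h \<le> hi \<longrightarrow> h * (g t - e) \<le> U (t + h) - U t"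
      using d(1) by blast
  qed
  moreover have "w hi * U hi - w lo * U lo + integral {lo..hi} (\<lambda>t. dens E t * U t)
      \<le> integral {lo..hi} (\<lambda>t. w t * g t)"
  proof (rule weighted_integral_ge_of_slope[OF lo_less_hi Uc wc dc w01 wf wg gK])
    fix e :: real assume "0 < e"
    then obtain d where d: "0 < d"
      "\<And>a x y. a \<in> lotteries E \<Longrightarrow> x \<in> types E \<Longrightarrow> y \<in> types E \<Longrightarrow> \<bar>y - x\<bar> < d \<Longrightarrow>
      \<bar>lottery_val E a y - lottery_val E a x - (y - x) * lottery_deriv a x\<bar> \<le> e * \<bar>y - x\<bar>"
      using lottery_val_uniformly_differentiable by blast
    \<comment> \<open>Now the lower type \<open>t - h\<close> imitates \<open>t\<close>, and
      \<open>g\<close> is evaluated at the right end.\<close>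
    have "U t - U (t - h) \<le> h * (g t + e)" if h: "0 < h" "h < d" "lo \<le> t - h" "t \<le> hi" for t h
    proof -
      have t: "t \<in> types E" "t - h \<in> types E" using h by (auto simp: types_eq)
      show ?thesis using d(2)[OF al[OF t(1)] t] ic'[OF t] h
        by (simp add: g_def abs_le_iff algebra_simps)
    qed
    then show "\<exists>d>0. \<forall>t h. 0 < h \<longrightarrow> h < d \<longrightarrow> lo \<le> t - h \<longrightarrow> t \<le> hi \<longrightarrow> U t - U (t - h) \<le> h * (g t + e)"
      using d(1) by blast
  qed
  ultimately have env: "integral {lo..hi} (\<lambda>t. w t * g t) = integral {lo..hi} (\<lambda>t. dens E t * U t) - U lo"
    by (simp add: w_def cdf_lo cdf_hi)
  have dU: "(\<lambda>t. dens E t * U t) integrable_on {lo..hi}"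
    using dc Uc by (intro integrable_continuous_real continuous_intros)
  have eq: "dens E t * lottery_virtual_val E (a t) t = dens E t * p t + dens E t * U t - w t * g t"
    if "t \<in> types E" for t
    using dens_pos[OF that] by (simp add: lottery_virtual_val_eq[OF al[OF that]] U_def w_def g_def field_simps)
  have i: "(\<lambda>t. dens E t * p t + dens E t * U t - w t * g t) integrable_on types E"
    using rev(2) dU wg by (intro integrable_diff integrable_add) (simp_all add: types_eq)
  then show "(\<lambda>t. dens E t * lottery_virtual_val E (a t) t) integrable_on types E"
    by (rule integrable_eq) (simp add: eq)
  have "integral (types E) (\<lambda>t. dens E t * lottery_virtual_val E (a t) t)
      = integral (types E) (\<lambda>t. dens E t * p t + dens E t * U t - w t * g t)"
    by (rule Henstock_Kurzweil_Integration.integral_cong) (rule eq)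
  also have "\<dots> = revenue E p + integral {lo..hi} (\<lambda>t. dens E t * U t) - integral {lo..hi} (\<lambda>t. w t * g t)"
    using rev dU wg by (simp add: types_eq Henstock_Kurzweil_Integration.integral_diff
        Henstock_Kurzweil_Integration.integral_add integrable_add)
  finally show "revenue E p = integral (types E) (\<lambda>t. dens E t * lottery_virtual_val E (a t) t)
      - (lottery_val E (a lo) lo - p lo)" using env by (simp add: U_def)
qed

section \<open>Pointwise maximisers of the virtual value\<close>

definition best :: "real \<Rightarrow> nat set set" where
  "best t = {b \<in> bundles E. \<forall>c\<in>bundles E. phi c t \<le> phi b t}"

definition essential :: "nat set set" where
  "essential = {b. \<exists>t\<in>types E. best t = {b}}"

lemma bestD: "b \<in> best t \<Longrightarrow> c \<in> bundles E \<Longrightarrow> phi c t \<le> phi b t"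
  by (simp add: best_def)

lemma best_subset: "best t \<subseteq> bundles E"
  by (auto simp: best_def)

lemma essential_subset: "essential \<subseteq> bundles E"
  using best_subset by (auto simp: essential_def)

lemma best_nonempty: "best t \<noteq> {}"
proof -
  let ?f = "\<lambda>b. phi b t"
  have fin: "finite (?f ` bundles E)" by simp
  have "?f ` bundles E \<noteq> {}" using empty_in_bundles by blast
  then have "Max (?f ` bundles E) \<in> ?f ` bundles E" by (rule Max_in[OF fin])
  then obtain b where "b \<in> bundles E" and b: "Max (?f ` bundles E) = ?f b" by (elim imageE)
  moreover have "?f c \<le> ?f b" if "c \<in> bundles E" for c
    unfolding b[symmetric] using that by (intro Max_ge fin) (rule imageI)
  ultimately have "b \<in> best t" by (simp add: best_def)
  then show ?thesis by blast
qed

lemma best_eq_singletonI: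
  assumes "b \<in> bundles E" "\<And>c. c \<in> bundles E \<Longrightarrow> c \<noteq> b \<Longrightarrow> phi c t < phi b t"
  shows "best t = {b}"
proof -
  have le: "phi c t \<le> phi b t" if "c \<in> bundles E" for c
    using assms(2)[OF that] less_imp_le by blast
  have "c = b" if "c \<in> best t" for c
  proof (rule ccontr)
    assume "c \<noteq> b"
    moreover have "c \<in> bundles E" "phi b t \<le> phi c t"
      using that assms(1) by (simp_all add: best_def)
    ultimately show False using assms(2)[of c] by simp
  qed
  moreover have "b \<in> best t" using le assms(1) by (simp add: best_def)
  ultimately show ?thesis by blast
qed

lemma best_lo: "best lo = {{}}"
  by (rule best_eq_singletonI) (simp_all add: phi_neg_lo phi_empty)

lemma lottery_virtual_val_le_best:
  assumes a: "a \<in> lotteries E" and b: "b \<in> best t"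
  shows "lottery_virtual_val E a t \<le> phi b t"
proof -
  have "lottery_virtual_val E a t = (\<Sum>c\<in>bundles E. pmf a c * phi c t)"
    by (simp add: lottery_virtual_val_def expectation_eq_sum[OF a])
  also have "\<dots> \<le> (\<Sum>c\<in>bundles E. pmf a c * phi b t)"
    using bestD[OF b] by (intro sum_mono mult_left_mono) auto
  also have "\<dots> = phi b t" using sum_pmf_bundles[OF a] by (simp flip: sum_distrib_right)
  finally show ?thesis .
qed

lemma lottery_virtual_val_return: "lottery_virtual_val E (return_pmf b) t = phi b t"
  and lottery_val_return: "lottery_val E (return_pmf b) t = val E b t"
  by (simp_all add: lottery_virtual_val_def lottery_val_def)

lemma val_deriv_le_if_mono:
  assumes b: "b \<in> bundles E" "c \<in> bundles E"
    and m: "mono_on (types E) (\<lambda>t. val E c t - val E b t)" and t: "t \<in> types E"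
  shows "val_deriv E b t \<le> val_deriv E c t"
proof -
  have "0 \<le> val_deriv E c t - val_deriv E b t"
  proof (rule has_real_derivative_within_nonneg_if_mono_on[OF lo_less_hi])
    show "t \<in> {lo..hi}" using t by (simp add: types_eq)
    show "((\<lambda>t. val E c t - val E b t) has_real_derivative val_deriv E c t - val_deriv E b t)
        (at t within {lo..hi})"
      using val_deriv(2)[OF b(1) t] val_deriv(2)[OF b(2) t] unfolding types_eq by (rule DERIV_diff[rotated])
    show "mono_on {lo..hi} (\<lambda>t. val E c t - val E b t)" using m by (simp add: types_eq)
  qed
  then show ?thesis by simp
qed

text \<open>Otherwise \<open>g = val c - val b\<close> is antitone, so
  \<open>d = phi c - phi b\<close> lies above \<open>g\<close> and meets it at \<open>hi\<close>.
  The data at \<open>s\<close> and \<open>t\<close> force the sign of \<open>d\<close> to be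
  increasing, whence \<open>0 \<le> d hi = g hi \<le> g s \<le> d s \<le> 0\<close>. So
  \<open>d s\<close> and \<open>d hi\<close> vanish, strictness makes \<open>d t\<close> positive,
  and the sign of \<open>d\<close> drops from \<open>t\<close> to \<open>hi\<close>, a
  contradiction.\<close>

lemma mono_val_diff_if_best_order:
  assumes bc: "b \<in> bundles E" "c \<in> bundles E"
    and sc: "single_crossing_on (types E) (\<lambda>t. phi c t - phi b t)"
    and mon: "monotonic_on (types E) (\<lambda>t. val E c t - val E b t)"
    and st: "s \<in> types E" "t \<in> types E" "s < t"
    and s: "phi c s \<le> phi b s" and t: "phi b t \<le> phi c t"
    and strict: "phi c s < phi b s \<or> phi b t < phi c t"
  shows "mono_on (types E) (\<lambda>t. val E c t - val E b t)"
proof (rule ccontr)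
  let ?g = "\<lambda>t. val E c t - val E b t" and ?d = "\<lambda>t. phi c t - phi b t"
  assume "\<not> mono_on (types E) ?g"
  then have am: "antimono_on (types E) ?g" using mon by (simp add: monotonic_on_def)
  have sgn_mono: "sgn (?d x) \<le> sgn (?d y)" if "x \<in> types E" "y \<in> types E" "x \<le> y" for x y
  proof -
    have "\<not> antimono_on (types E) (\<lambda>t. sgn (?d t))"
    proof
      assume "antimono_on (types E) (\<lambda>t. sgn (?d t))"
      then have "sgn (?d t) \<le> sgn (?d s)" by (rule monotone_onD) (use st in simp_all)
      then show False using s t strict by (auto simp: sgn_if split: if_splits)
    qed
    then show ?thesis using sc that unfolding single_crossing_on_def monotonic_on_def
      by (auto dest: mono_onD)
  qed
  have ge: "?g x \<le> ?d x" if x: "x \<in> types E" for x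
  proof -
    have "mono_on (types E) (\<lambda>t. val E b t - val E c t)"
      using monotone_onD[OF am] by (intro mono_onI) (simp add: algebra_simps)
    then have "val_deriv E c x \<le> val_deriv E b x" by (rule val_deriv_le_if_mono[OF bc(2,1) _ x])
    moreover have "0 \<le> (1 - F x) / dens E x" using cdf_bounds[OF x] dens_pos[OF x] by simp
    ultimately have "(1 - F x) / dens E x * val_deriv E c x \<le> (1 - F x) / dens E x * val_deriv E b x"
      by (rule mult_left_mono)
    then show ?thesis by (simp add: virtual_val_def)
  qed
  have g_hi: "?g hi = ?d hi" by (simp add: phi_hi)
  have "sgn (?d t) \<le> sgn (?d hi)" using sgn_mono st by (auto simp: types_eq)
  then have "0 \<le> ?g hi" using t unfolding g_hi by (auto simp: sgn_if split: if_splits)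
  moreover have "?g hi \<le> ?g s"
    using monotone_onD[OF am st(1) lo_hi_in_types(2)] st by (simp add: types_eq)
  ultimately have "0 \<le> ?d s" "?g hi = 0" using ge[OF st(1)] s by linarith+
  then have "?d hi = 0" "phi b t < phi c t" using strict g_hi by auto
  then show False using \<open>sgn (?d t) \<le> sgn (?d hi)\<close> by simp
qed

end

subsection \<open>Implementing the best bundles and optimal menus\<close>

locale regular_pricing_problem = pricing_problem +
  assumes A1: "\<And>b b'. b \<in> bundles E \<Longrightarrow> b' \<in> bundles E \<Longrightarrow>
      single_crossing_on (types E) (\<lambda>t. virtual_val E b t - virtual_val E b' t) \<and>
      monotonic_on (types E) (\<lambda>t. val E b t - val E b' t)"
begin

text \<open>Ties between two bundles may persist on an interval of types. Breaking them by a fixed ranking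
  keeps two such bundles from alternating along the interval, which could violate IC.\<close>

lemma best_selection:
  assumes hit: "\<And>t. t \<in> types E \<Longrightarrow> best t \<inter> S \<noteq> {}"
  obtains sel where "\<And>t. t \<in> types E \<Longrightarrow> sel t \<in> best t \<inter> S"
    "\<And>b. {t \<in> types E. sel t = b} \<in> sets borel"
    "\<And>s t. s \<in> types E \<Longrightarrow> t \<in> types E \<Longrightarrow> s < t \<Longrightarrow>
      mono_on (types E) (\<lambda>x. val E (sel t) x - val E (sel s) x)"
proof -
  obtain idx :: "nat set \<Rightarrow> nat" where idx: "inj_on idx (bundles E)"
    using finite_imp_inj_to_nat_seg[OF finite_bundles] by blast
  define sel where "sel t = arg_min idx (\<lambda>b. b \<in> best t \<inter> S)" for t
  have sel: "sel t \<in> best t \<inter> S" "\<And>c. c \<in> best t \<inter> S \<Longrightarrow> idx (sel t) \<le> idx c"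
    if t: "t \<in> types E" for t
  proof -
    obtain b where "b \<in> best t \<inter> S" using hit[OF t] by blast
    then have "sel t \<in> best t \<inter> S \<and> (\<forall>c. c \<in> best t \<inter> S \<longrightarrow> idx (sel t) \<le> idx c)"
      unfolding sel_def by (rule arg_min_nat_lemma)
    then    show "sel t \<in> best t \<inter> S" "\<And>c. c \<in> best t \<inter> S \<Longrightarrow> idx (sel t) \<le> idx c"
      by blast+
  qed
  have sel_b: "sel t \<in> bundles E" if "t \<in> types E" for t using sel(1)[OF that] best_subset by blast
  \<comment> \<open>Quantifying over the finite set \<open>bundles E\<close> writes
    \<open>sel t = b\<close> as a finite Boolean combination of measurable conditions.\<close>
  have sel_iff: "sel t = b \<longleftrightarrow> b \<in> best t \<inter> S \<and> (\<forall>c\<in>bundles E. c \<in> best t \<inter> S \<longrightarrow> idx b \<le> idx c)"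
    if "t \<in> types E" for t b
  proof
    assume "b \<in> best t \<inter> S \<and> (\<forall>c\<in>bundles E. c \<in> best t \<inter> S \<longrightarrow> idx b \<le> idx c)"
    then have "idx (sel t) = idx b" "b \<in> bundles E"
      using sel[OF that] sel_b[OF that] best_subset by (auto intro: antisym)
    then show "sel t = b" using idx sel_b[OF that] by (auto dest: inj_onD)
  qed (use sel[OF that] in auto)
  let ?R = "restrict_space borel (types E)"
  have phi_m: "phi c \<in> borel_measurable ?R" if "c \<in> bundles E" for c
    by (rule borel_measurable_continuous_on_restrict[OF phi_continuous[OF that]])
  have best_m: "Measurable.pred ?R (\<lambda>t. b \<in> best t)" for b
  proof (cases "b \<in> bundles E")
    case True
    have "Measurable.pred ?R (\<lambda>t. \<forall>c\<in>bundles E. phi c t \<le> phi b t)"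
    proof (rule pred_intros_finite(3)[OF finite_bundles])
      fix c assume "c \<in> bundles E"
      then show "Measurable.pred ?R (\<lambda>t. phi c t \<le> phi b t)"
        unfolding pred_def by (intro borel_measurable_le phi_m True)
    qed
    then show ?thesis using True by (simp add: best_def)
  qed (simp add: best_def)
  show ?thesis
  proof (rule that)
    show "sel t \<in> best t \<inter> S" if "t \<in> types E" for t by (rule sel(1)[OF that])
    fix b
    have "Measurable.pred ?R (\<lambda>t. b \<in> best t \<inter> S \<and> (\<forall>c\<in>bundles E. c \<in> best t \<inter> S \<longrightarrow> idx b \<le> idx c))"
      using best_m by (intro pred_intros_logic pred_intros_finite(3)) auto
    then have "{t \<in> space ?R. b \<in> best t \<inter> S \<and> (\<forall>c\<in>bundles E. c \<in> best t \<inter> S \<longrightarrow> idx b \<le> idx c)}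
        \<in> sets ?R"
      by (simp add: pred_def)
    also have "{t \<in> space ?R. b \<in> best t \<inter> S \<and> (\<forall>c\<in>bundles E. c \<in> best t \<inter> S \<longrightarrow> idx b \<le> idx c)}
        = {t \<in> types E. sel t = b}"
      using sel_iff by (auto simp: space_restrict_space)
    finally show "{t \<in> types E. sel t = b} \<in> sets borel"
      by (subst (asm) sets_restrict_space_iff) (use types_sets_borel in auto)
  next
    fix s t assume st: "s \<in> types E" "t \<in> types E" "s < t"
    show "mono_on (types E) (\<lambda>x. val E (sel t) x - val E (sel s) x)"
    proof (cases "sel s = sel t")
      case False
      note b = sel_b[OF st(1)] sel_b[OF st(2)]
      have le: "phi (sel t) s \<le> phi (sel s) s" "phi (sel s) t \<le> phi (sel t) t"
        using sel(1) st bestD b by blast+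
      \<comment> \<open>If both comparisons were ties, both bundles would be available at both
        types, and the common ranking would select the same one twice.\<close>
      have "phi (sel t) s < phi (sel s) s \<or> phi (sel s) t < phi (sel t) t"
      proof (rule ccontr)
        assume "\<not> ?thesis"
        then have "phi (sel t) s = phi (sel s) s" "phi (sel s) t = phi (sel t) t" using le by auto
        then have "sel t \<in> best s \<inter> S" "sel s \<in> best t \<inter> S"
          using sel(1)[OF st(1)] sel(1)[OF st(2)] b by (auto simp: best_def)
        then have "idx (sel s) = idx (sel t)" using sel(2) st by (blast intro: antisym)
        then show False using False idx b by (auto dest: inj_onD)
      qed
      then show ?thesis
        using mono_val_diff_if_best_order[OF b _ _ st le] A1[OF b(2,1)] by blast
    qed (simp add: mono_on_def)
  qed
qed

text \<open>The payment leaves each type the integral of the marginal values of the bundles selected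
  up to it. At any given type, bundles selected by higher types have larger marginal values, so
  imitation never gains more than the difference of these integrals. The lowest type gets the empty
  bundle at price 0; IR holds because every type may imitate it.\<close>

lemma best_implementable:
  assumes hit: "\<And>t. t \<in> types E \<Longrightarrow> best t \<inter> S \<noteq> {}"
  obtains sel p where "\<And>t. t \<in> types E \<Longrightarrow> sel t \<in> best t \<inter> S"
    "feasible E (\<lambda>t. return_pmf (sel t)) p" "p lo = 0"
proof -
  obtain sel where sel: "\<And>t. t \<in> types E \<Longrightarrow> sel t \<in> best t \<inter> S"
    and sel_m: "\<And>b. {t \<in> types E. sel t = b} \<in> sets borel"
    and sel_mono: "\<And>s t. s \<in> types E \<Longrightarrow> t \<in> types E \<Longrightarrow> s < t \<Longrightarrow>
      mono_on (types E) (\<lambda>x. val E (sel t) x - val E (sel s) x)"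
    using best_selection[OF hit] by blast
  let ?a = "\<lambda>t. return_pmf (sel t)" and ?R = "restrict_space borel (types E)"
  have sb: "sel t \<in> bundles E" if "t \<in> types E" for t using sel[OF that] best_subset by blast
  have sel_lo: "sel lo = {}" using sel[of lo] best_lo by simp
  have am: "(\<lambda>t. pmf (?a t) b) \<in> borel_measurable ?R" for b
  proof -
    have "(\<lambda>t. indicator {t \<in> types E. sel t = b} t :: real) \<in> borel_measurable ?R"
      by (intro measurable_restrict_space1 borel_measurable_indicator sel_m)
    then show ?thesis
      by (rule measurable_cong[THEN iffD1, rotated]) (auto simp: space_restrict_space indicator_def)
  qed
  have sum_eq: "(\<Sum>b\<in>bundles E. pmf (?a t) b * x b t) = x (sel t) t" if "t \<in> types E"
    for t and x :: "nat set \<Rightarrow> real \<Rightarrow> real"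
  proof -
    have "(\<Sum>b\<in>bundles E. pmf (?a t) b * x b t) = (\<Sum>b\<in>bundles E. if b = sel t then x b t else 0)"
      by (rule sum.cong) (auto simp: indicator_def)
    then show ?thesis using sb[OF that] by simp
  qed
  have m: "(\<lambda>t. x (sel t) t) \<in> borel_measurable ?R"
    if "\<And>b. b \<in> bundles E \<Longrightarrow> continuous_on (types E) (x b)" for x :: "nat set \<Rightarrow> real \<Rightarrow> real"
  proof -
    have "(\<lambda>t. \<Sum>b\<in>bundles E. pmf (?a t) b * x b t) \<in> borel_measurable ?R"
      by (intro measurable_lottery_sum am that)
    then show ?thesis
      by (rule measurable_cong[THEN iffD1, rotated]) (rule sum_eq, simp add: space_restrict_space)
  qed
  obtain K where K: "\<And>b t. b \<in> bundles E \<Longrightarrow> t \<in> types E \<Longrightarrow> \<bar>val_deriv E b t\<bar> \<le> K"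
    using val_deriv_bounded by blast
  define g where "g t = val_deriv E (sel t) t" for t
  have "g integrable_on {lo..hi}"
    using m[of "val_deriv E", OF val_deriv(1)] K[OF sb]
    unfolding g_def by (intro bounded_measurable_integrable_Icc(2)) (auto simp: types_eq)
  then have gi: "g integrable_on {x..y}" if "lo \<le> x" "y \<le> hi" for x y
    using that by (intro integrable_on_subinterval[OF \<open>g integrable_on {lo..hi}\<close>]) auto
  define U where "U t = integral {lo..t} g" for t
  define p where "p t = val E (sel t) t - U t" for t
  have U_diff: "U t - U s = integral {s..t} g" if "lo \<le> s" "s \<le> t" "t \<le> hi" for s t
    using Henstock_Kurzweil_Integration.integral_combine[OF that(1,2) gi[OF order.refl that(3)]]
    by (simp add: U_def)
  have ftc: "(val_deriv E b has_integral val E b y - val E b x) {x..y}"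
    if "b \<in> bundles E" "lo \<le> x" "x \<le> y" "y \<le> hi" for b x y
  proof (rule fundamental_theorem_of_calculus[OF that(3)])
    fix z assume "z \<in> {x..y}"
    then show "(val E b has_vector_derivative val_deriv E b z) (at z within {x..y})"
      unfolding has_real_derivative_iff_has_vector_derivative[symmetric]
      by (intro DERIV_subset[OF val_deriv(2)[OF that(1)]]) (use that in \<open>auto simp: types_eq\<close>)
  qed
  have g_le: "g s \<le> val_deriv E (sel t) s" and g_ge: "val_deriv E (sel s) t \<le> g t"
    if "lo \<le> s" "s \<le> t" "t \<le> hi" for s t
  proof -
    have st: "s \<in> types E" "t \<in> types E" using that by (auto simp: types_eq)
    show "g s \<le> val_deriv E (sel t) s" "val_deriv E (sel s) t \<le> g t"
      using val_deriv_le_if_mono[OF sb[OF st(1)] sb[OF st(2)] sel_mono[OF st]] st that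
      unfolding g_def by (cases "s = t"; auto)+
  qed
  have ic: "val E (sel s) t - val E (sel s) s \<le> U t - U s" if st: "s \<in> types E" "t \<in> types E" for s t
  proof (cases "s \<le> t")
    case True
    then have b: "lo \<le> s" "s \<le> t" "t \<le> hi" using st by (auto simp: types_eq)
    have "integral {s..t} (val_deriv E (sel s)) \<le> integral {s..t} g"
      using ftc[OF sb[OF st(1)] b] gi[of s t] g_ge b by (intro integral_le) auto
    then show ?thesis using U_diff[OF b] integral_unique[OF ftc[OF sb[OF st(1)] b]] by simp
  next
    case False
    then have b: "lo \<le> t" "t \<le> s" "s \<le> hi" using st by (auto simp: types_eq)
    have "integral {t..s} g \<le> integral {t..s} (val_deriv E (sel s))"
      using ftc[OF sb[OF st(1)] b] gi[of t s] g_le b by (intro integral_le) auto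
    then show ?thesis using U_diff[OF b] integral_unique[OF ftc[OF sb[OF st(1)] b]] by simp
  qed
  have U_lo: "U lo = 0" by (simp add: U_def)
  have "continuous_on (types E) U"
    unfolding U_def types_eq by (rule indefinite_integral_continuous_1[OF gi]) auto
  then have "p \<in> borel_measurable ?R"
    unfolding p_def
    by (intro borel_measurable_diff m val_continuous borel_measurable_continuous_on_restrict)
  then have "mechanism E ?a p"
    using am sb by (simp add: mechanism_def return_in_lotteries)
  moreover have "IC E ?a p"
    unfolding IC_def using ic by (force simp: lottery_val_return p_def)
  moreover have "IR E ?a p"
    unfolding IR_def
  proof
    fix t assume t: "t \<in> types E"
    show "0 \<le> lottery_val E (?a t) t - p t"
      using ic[OF lo_hi_in_types(1) t] t by (simp add: sel_lo val_empty U_lo lottery_val_return p_def)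
  qed
  ultimately have "feasible E ?a p" by (simp add: feasible_def)
  moreover have "p lo = 0" by (simp add: p_def sel_lo val_empty U_lo)
  ultimately show ?thesis using that sel by blast
qed

text \<open>The lowest type has no rent, so revenue is exactly the integral of the maximal virtual
  value. In any other feasible mechanism a rent at \<open>lo\<close> or an inferior allocation can
  only lower it.\<close>

lemma optimal_mechanism_if_best:
  assumes sel: "\<And>t. t \<in> types E \<Longrightarrow> sel t \<in> best t"
    and feas: "feasible E (\<lambda>t. return_pmf (sel t)) p" and p: "p lo = 0"
  shows "optimal_mechanism E (\<lambda>t. return_pmf (sel t)) p"
    and "revenue E p = integral (types E) (\<lambda>t. dens E t * phi (sel t) t)"
    and "(\<lambda>t. dens E t * phi (sel t) t) integrable_on types E"
proof -
  have "sel lo = {}" using sel[of lo] best_lo by simp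
  then show rev: "revenue E p = integral (types E) (\<lambda>t. dens E t * phi (sel t) t)"
    and int: "(\<lambda>t. dens E t * phi (sel t) t) integrable_on types E"
    using IC_revenue[of "\<lambda>t. return_pmf (sel t)" p] feas p
    by (simp_all add: feasible_def lottery_virtual_val_return lottery_val_return val_empty)
  show "optimal_mechanism E (\<lambda>t. return_pmf (sel t)) p"
    unfolding optimal_mechanism_def
  proof (intro conjI feas allI impI)
    fix a' p' assume f: "feasible E a' p'"
    then have m: "mechanism E a' p'" "IC E a' p'" and "0 \<le> lottery_val E (a' lo) lo - p' lo"
      by (simp_all add: feasible_def IR_def)
    then have "revenue E p' \<le> integral (types E) (\<lambda>t. dens E t * lottery_virtual_val E (a' t) t)"
      using IC_revenue(1)[OF m] by simp
    also have "\<dots> \<le> revenue E p"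
      unfolding rev
    proof (rule integral_le[OF IC_revenue(2)[OF m] int])
      fix t assume t: "t \<in> types E"
      then have "a' t \<in> lotteries E" using m by (simp add: mechanism_def)
      then show "dens E t * lottery_virtual_val E (a' t) t \<le> dens E t * phi (sel t) t"
        using lottery_virtual_val_le_best[OF _ sel[OF t]] dens_pos[OF t]
        by (simp add: mult_left_mono)
    qed
    finally show "revenue E p' \<le> revenue E p" .
  qed
qed

text \<open>Continuity and finiteness of the set of rivals let a strict gap persist nearby. The
  common margin \<open>d\<close> on a nondegenerate interval later becomes a definite loss of
  revenue.\<close>

lemma unique_best_on_interval:
  assumes t: "t \<in> types E" and best: "best t = {b}"
  obtains x y d where "lo \<le> x" "x < y" "y \<le> hi" "0 < d"
    "\<And>s c. s \<in> {x..y} \<Longrightarrow> c \<in> bundles E \<Longrightarrow> c \<noteq> b \<Longrightarrow> d < dens E s * (phi b s - phi c s)"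
proof -
  let ?k = "\<lambda>c s. dens E s * (phi b s - phi c s)"
  have b: "b \<in> bundles E" using best best_subset by blast
  have lt: "phi c t < phi b t" if c: "c \<in> bundles E" "c \<noteq> b" for c
  proof (rule ccontr)
    assume "\<not> phi c t < phi b t"
    moreover have "b \<in> best t" using best by simp
    ultimately have "c \<in> best t" using c by (auto simp: best_def not_less intro: order_trans)
    then show False using best c by simp
  qed
  have kpos: "0 < ?k c t" if "c \<in> bundles E" "c \<noteq> b" for c
    using lt[OF that] dens_pos[OF t] by simp
  \<comment> \<open>The inserted 1 keeps the set nonempty, so that no rival has to be
    exhibited.\<close>
  have "0 < Min (insert 1 ((\<lambda>c. ?k c t) ` (bundles E - {b})))"
    using kpos by (subst Min_gr_iff) auto
  then obtain d where d: "0 < d" "d < Min (insert 1 ((\<lambda>c. ?k c t) ` (bundles E - {b})))"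
    using dense by blast
  then have dk: "d < ?k c t" if "c \<in> bundles E" "c \<noteq> b" for c
    using that by (subst (asm) Min_gr_iff) auto
  have "\<forall>\<^sub>F s in at t within types E. d < ?k c s" if "c \<in> bundles E - {b}" for c
  proof -
    have "continuous_on (types E) (?k c)"
      using that b by (intro continuous_intros dens_continuous phi_continuous) auto
    then have "(?k c \<longlongrightarrow> ?k c t) (at t within types E)" using t by (simp add: continuous_on_def)
    then show ?thesis by (rule order_tendstoD(1)) (use dk that in simp)
  qed
  then have "\<forall>\<^sub>F s in at t within types E. \<forall>c\<in>bundles E - {b}. d < ?k c s"
    by (intro eventually_ball_finite) auto
  then obtain r where r: "0 < r" and
    "\<And>s. s \<in> types E \<Longrightarrow> s \<noteq> t \<Longrightarrow> dist s t < r \<Longrightarrow> \<forall>c\<in>bundles E - {b}. d < ?k c s"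
    unfolding eventually_at by auto
  then have rk: "d < ?k c s" if "s \<in> types E" "\<bar>s - t\<bar> < r" "c \<in> bundles E" "c \<noteq> b" for s c
    using that dk by (cases "s = t") (auto simp: dist_real_def)
  define x where "x = max lo (t - r / 2)"
  define y where "y = min hi (t + r / 2)"
  show ?thesis
  proof (rule that[of x y d])
    show "lo \<le> x" "y \<le> hi" "x < y"
      using t r lo_less_hi by (auto simp: x_def y_def types_eq)
    show "d < ?k c s" if "s \<in> {x..y}" "c \<in> bundles E" "c \<noteq> b" for s c
      using that r by (intro rk) (auto simp: x_def y_def types_eq abs_if)
  qed (rule d(1))
qed

text \<open>\<open>optimal_menu\<close> only bounds the bundles in use, so enlarging a menu within
  \<open>bundles E\<close> is harmless and selecting from \<open>essential\<close> is enough.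
  Conversely, a mechanism avoiding an essential \<open>b\<close> loses a fixed margin on the
  interval where \<open>b\<close> is strictly best, and recovers it nowhere.\<close>

theorem optimal_menu_iff:
  assumes hit: "\<And>t. t \<in> types E \<Longrightarrow> best t \<inter> essential \<noteq> {}"
  shows "optimal_menu E B \<longleftrightarrow> essential \<subseteq> B \<and> B \<subseteq> bundles E"
proof -
  obtain sel p where sel: "\<And>t. t \<in> types E \<Longrightarrow> sel t \<in> best t \<inter> essential"
    and feas: "feasible E (\<lambda>t. return_pmf (sel t)) p" and p0: "p lo = 0"
    using best_implementable[OF hit] by blast
  have sel_best: "\<And>t. t \<in> types E \<Longrightarrow> sel t \<in> best t" using sel by blast
  have opt: "optimal_mechanism E (\<lambda>t. return_pmf (sel t)) p"
    "revenue E p = integral (types E) (\<lambda>t. dens E t * phi (sel t) t)"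
    "(\<lambda>t. dens E t * phi (sel t) t) integrable_on types E"
    by (rule optimal_mechanism_if_best[OF _ feas p0], erule sel_best)+
  show ?thesis
  proof
    assume "essential \<subseteq> B \<and> B \<subseteq> bundles E"
    moreover from this have "\<forall>t\<in>types E. return_pmf (sel t) \<in> return_pmf ` B"
      using sel by (intro ballI imageI) blast
    with opt(1) have "\<exists>a p. optimal_mechanism E a p \<and> (\<forall>t\<in>types E. a t \<in> return_pmf ` B)"
      by (intro exI conjI)
    ultimately show "optimal_menu E B" by (simp add: optimal_menu_def)
  next
    assume "optimal_menu E B"
    then have BB: "B \<subseteq> bundles E" and
      "\<exists>a p. optimal_mechanism E a p \<and> (\<forall>t\<in>types E. a t \<in> return_pmf ` B)"
      by (simp_all add: optimal_menu_def)
    then obtain a' p' where *: "optimal_mechanism E a' p' \<and> (\<forall>t\<in>types E. a' t \<in> return_pmf ` B)"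
      by (elim exE)
    note opt' = *[THEN conjunct1] and menu = bspec[OF *[THEN conjunct2]]
    from opt' have "feasible E a' p'" and le: "revenue E p \<le> revenue E p'"
      using feas unfolding optimal_mechanism_def by blast+
    then have f': "mechanism E a' p'" "IC E a' p'" "0 \<le> lottery_val E (a' lo) lo - p' lo"
      by (simp_all add: feasible_def IR_def)
    \<comment> \<open>The pointwise shortfall of the given optimal mechanism: nonnegative, yet of
      integral at most 0 by optimality and by IR at \<open>lo\<close>.\<close>
    define h where "h t = dens E t * phi (sel t) t - dens E t * lottery_virtual_val E (a' t) t" for t
    have hi: "h integrable_on types E"
      unfolding h_def by (rule integrable_diff[OF opt(3) IC_revenue(2)[OF f'(1,2)]])
    have h0: "integral (types E) h \<le> 0"
      using le opt(2) IC_revenue(1)[OF f'(1,2)] f'(3)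
        Henstock_Kurzweil_Integration.integral_diff[OF opt(3) IC_revenue(2)[OF f'(1,2)]]
      unfolding h_def by linarith
    have h_nonneg: "0 \<le> h t" if t: "t \<in> types E" for t
    proof -
      have "a' t \<in> lotteries E" using f'(1) t by (simp add: mechanism_def)
      then show ?thesis
        using lottery_virtual_val_le_best[OF _ sel_best[OF t]] dens_pos[OF t]
        by (simp add: h_def mult_left_mono)
    qed
    have "b \<in> B" if ess: "b \<in> essential" for b
    proof (rule ccontr)
      assume nb: "b \<notin> B"
      have "\<exists>t\<in>types E. best t = {b}" using ess by (simp add: essential_def)
      then obtain t where t: "t \<in> types E" "best t = {b}" by (elim bexE)
      have b: "b \<in> bundles E" using ess essential_subset by blast
      obtain x y d where xy: "lo \<le> x" "x < y" "y \<le> hi" and d: "0 < d" and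
        dk: "\<And>s c. s \<in> {x..y} \<Longrightarrow> c \<in> bundles E \<Longrightarrow> c \<noteq> b \<Longrightarrow> d < dens E s * (phi b s - phi c s)"
        using unique_best_on_interval[OF t] by blast
      have sub: "{x..y} \<subseteq> types E" using xy by (simp add: types_eq)
      have hxy: "h integrable_on {x..y}"
        by (rule integrable_on_subinterval[OF hi sub])
      have "0 < (y - x) * d" using xy d by simp
      also have "(y - x) * d = integral {x..y} (\<lambda>s. d)" using xy by simp
      also have "\<dots> \<le> integral {x..y} h"
      proof (rule integral_le[OF integrable_const_ivl hxy])
        fix s assume s: "s \<in> {x..y}"
        then have sT: "s \<in> types E" by (rule subsetD[OF sub])
        obtain c where c: "a' s = return_pmf c" "c \<in> B" using menu[OF sT] by (elim imageE)
        have "c \<in> bundles E" using BB c(2) by (rule subsetD)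
        moreover have "c \<noteq> b"
        proof
          assume "c = b"
          then show False using c(2) nb by simp
        qed
        ultimately have "d < dens E s * (phi b s - phi c s)" by (rule dk[OF s])
        also have "\<dots> \<le> dens E s * (phi (sel s) s - phi c s)"
          using bestD[OF sel_best[OF sT] b] dens_pos[OF sT] by simp
        finally show "d \<le> h s" by (simp add: h_def c(1) lottery_virtual_val_return right_diff_distrib)
      qed
      also have "\<dots> \<le> integral (types E) h"
        using integral_subset_le[OF sub hxy hi] h_nonneg by blast
      finally show False using h0 by simp
    qed
    then show "essential \<subseteq> B \<and> B \<subseteq> bundles E" using BB by blast
  qed
qed

corollary minimal_optimal_menu_iff:
  assumes hit: "\<And>t. t \<in> types E \<Longrightarrow> best t \<inter> essential \<noteq> {}"
  shows "minimal_optimal_menu E B \<longleftrightarrow> B = essential"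
proof -
  have iff: "optimal_menu E C \<longleftrightarrow> essential \<subseteq> C \<and> C \<subseteq> bundles E" for C
    by (rule optimal_menu_iff) (rule hit)
  show ?thesis
  proof
    assume "minimal_optimal_menu E B"
    then have "essential \<subseteq> B" and "\<forall>C. C \<subset> B \<longrightarrow> \<not> (essential \<subseteq> C \<and> C \<subseteq> bundles E)"
      by (simp_all add: minimal_optimal_menu_def iff)
    then have "\<not> essential \<subset> B" using essential_subset by blast
    with \<open>essential \<subseteq> B\<close> show "B = essential" by blast
  next
    assume "B = essential"
    moreover have "optimal_menu E essential" using essential_subset by (simp add: iff)
    moreover have "\<not> optimal_menu E C" if "C \<subset> essential" for C using that unfolding iff by blast
    ultimately show "minimal_optimal_menu E B" unfolding minimal_optimal_menu_def by blast
  qed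
qed

end

subsection \<open>The plane of virtual values\<close>

lemma single_crossing_neg_before:
  fixes g :: "real \<Rightarrow> real"
  assumes sc: "single_crossing_on A g" and A: "t \<in> A" "u \<in> A" "z \<in> A" and le: "t \<le> u" "u \<le> z"
    and u: "g u < 0" and z: "0 < g z"
  shows "g t < 0"
proof -
  have "\<not> antimono_on A (\<lambda>t. sgn (g t))"
  proof
    assume "antimono_on A (\<lambda>t. sgn (g t))"
    from monotone_onD[OF this A(2,3) le(2)] show False using u z by simp
  qed
  then have "mono_on A (\<lambda>t. sgn (g t))"
    using sc by (simp add: single_crossing_on_def monotonic_on_def)
  from mono_onD[OF this A(1,2) le(1)] show ?thesis using u by (simp add: sgn_if split: if_splits)
qed

lemma single_crossing_between:
  fixes g :: "real \<Rightarrow> real"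
  assumes sc: "single_crossing_on A g" and A: "u \<in> A" "t \<in> A" "z \<in> A" and le: "u \<le> t" "t \<le> z"
  shows "0 \<le> g u \<Longrightarrow> 0 \<le> g z \<Longrightarrow> 0 \<le> g t"
    and "0 < g u \<Longrightarrow> 0 < g z \<Longrightarrow> 0 < g t"
    and "g u = 0 \<Longrightarrow> g z = 0 \<Longrightarrow> g t = 0"
proof -
  have "sgn (g u) \<le> sgn (g t) \<and> sgn (g t) \<le> sgn (g z)
      \<or> sgn (g z) \<le> sgn (g t) \<and> sgn (g t) \<le> sgn (g u)"
  proof (cases "mono_on A (\<lambda>t. sgn (g t))")
    case True
    then show ?thesis using monotone_onD[OF True A(1,2) le(1)] monotone_onD[OF True A(2,3) le(2)]
      by blast
  next
    case False
    then have "antimono_on A (\<lambda>t. sgn (g t))"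
      using sc by (simp add: single_crossing_on_def monotonic_on_def)
    note m = monotone_onD[OF this]
    show ?thesis using m[OF A(1,2) le(1)] m[OF A(2,3) le(2)] by blast
  qed
  then show "0 \<le> g u \<Longrightarrow> 0 \<le> g z \<Longrightarrow> 0 \<le> g t" "0 < g u \<Longrightarrow> 0 < g z \<Longrightarrow> 0 < g t"
    "g u = 0 \<Longrightarrow> g z = 0 \<Longrightarrow> g t = 0"
    by (auto simp: sgn_if split: if_splits)
qed

lemma single_crossing_on_scale:
  fixes g :: "real \<Rightarrow> real"
  assumes "single_crossing_on A g" "0 < k"
  shows "single_crossing_on A (\<lambda>t. k * g t)"
  using assms by (simp add: single_crossing_on_def sgn_mult)

lemma finite_pmf_exists:
  fixes f :: "'a \<Rightarrow> real"
  assumes A: "finite A" and nn: "\<And>x. x \<in> A \<Longrightarrow> 0 \<le> f x" and s: "(\<Sum>x\<in>A. f x) = 1"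
  obtains a where "set_pmf a \<subseteq> A" "\<And>x. x \<in> A \<Longrightarrow> pmf a x = f x"
proof -
  define g where "g x = (if x \<in> A then f x else 0)" for x
  have g: "0 \<le> g x" for x using nn by (simp add: g_def)
  have "(\<integral>\<^sup>+x. ennreal (g x) \<partial>count_space UNIV) = (\<Sum>x\<in>A. ennreal (g x))"
    by (rule nn_integral_count_space'[OF A]) (auto simp: g_def)
  also have "\<dots> = ennreal (\<Sum>x\<in>A. g x)" by (rule sum_ennreal) (rule g)
  also have "(\<Sum>x\<in>A. g x) = 1" using s by (simp add: g_def)
  finally have 1: "(\<integral>\<^sup>+x. ennreal (g x) \<partial>count_space UNIV) = 1" by simp
  show ?thesis
  proof (rule that)
    show "set_pmf (embed_pmf g) \<subseteq> A" unfolding set_embed_pmf[OF g 1] by (auto simp: g_def)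
    show "pmf (embed_pmf g) x = f x" if "x \<in> A" for x
      using that by (simp add: pmf_embed_pmf[OF g 1] g_def)
  qed
qed

lemma eventually_perturbation_neg:
  fixes x y :: real
  assumes "x < 0 \<or> x = 0 \<and> y < 0"
  shows "\<forall>\<^sub>F e in at_right 0. x + e * y < 0"
  using assms
proof
  assume x: "x < 0"
  have "((\<lambda>e. x + e * y) \<longlongrightarrow> x + 0 * y) (at_right 0)" by (intro tendsto_intros)
  then show ?thesis using x by (intro order_tendstoD(2)) auto
next
  assume "x = 0 \<and> y < 0"
  then show ?thesis
    by (intro eventually_mono[OF eventually_at_right_less[of "0::real"]]) (simp add: mult_pos_neg)
qed

locale single_crossing_pricing_problem = regular_pricing_problem +
  assumes A2: "\<And>a a'. a \<in> lotteries E \<Longrightarrow> a' \<in> lotteries E \<Longrightarrow>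
      single_crossing_on (types E) (\<lambda>t. lottery_virtual_val E a t - lottery_virtual_val E a' t)"
begin

text \<open>The empty bundle has virtual value zero, so it can absorb the missing probability mass: every
  linear combination of virtual values is a multiple of a difference of two lotteries.\<close>

lemma linear_combination_single_crossing:
  "single_crossing_on (types E) (\<lambda>t. \<Sum>b\<in>bundles E. c b * phi b t)"
proof -
  \<comment> \<open>\<open>N\<close> dominates the total weight of the positive and of the negative
    part of \<open>c\<close>; the added 1 keeps it positive when all coefficients vanish.\<close>
  define N where "N = 1 + (\<Sum>b\<in>bundles E. \<bar>c b\<bar>)"
  have N: "0 < N" unfolding N_def by (simp add: add_pos_nonneg sum_nonneg)
  have lottery: "\<exists>a\<in>lotteries E. \<forall>t\<in>types E. lottery_virtual_val E a t = (\<Sum>b\<in>bundles E. h b * phi b t) / N"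
    if h: "\<And>b. 0 \<le> h b" "\<And>b. h b \<le> \<bar>c b\<bar>" for h
  proof -
    define f where "f b = h b / N + (if b = {} then 1 - (\<Sum>b\<in>bundles E. h b / N) else 0)" for b
    have "(\<Sum>b\<in>bundles E. h b) \<le> N" unfolding N_def using h(2) by (simp add: sum_mono add_increasing)
    then have "(\<Sum>b\<in>bundles E. h b / N) \<le> 1" using N by (simp flip: sum_divide_distrib)
    then have nn: "0 \<le> f b" for b using h(1)[of b] N by (simp add: f_def)
    have "(\<Sum>b\<in>bundles E. f b) = 1" by (simp add: f_def sum.distrib)
    then obtain a where a: "set_pmf a \<subseteq> bundles E" "\<And>b. b \<in> bundles E \<Longrightarrow> pmf a b = f b"
      using finite_pmf_exists[OF finite_bundles, of f] nn by metis
    have al: "a \<in> lotteries E" using a(1) by (simp add: lotteries_def)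
    have "lottery_virtual_val E a t = (\<Sum>b\<in>bundles E. h b * phi b t) / N" if t: "t \<in> types E" for t
    proof -
      have "lottery_virtual_val E a t = (\<Sum>b\<in>bundles E. f b * phi b t)"
        by (simp add: lottery_virtual_val_def expectation_eq_sum[OF al] a(2))
      also have "\<dots> = (\<Sum>b\<in>bundles E. h b * phi b t / N)"
        by (rule sum.cong) (auto simp: f_def phi_empty[OF t])
      finally show ?thesis by (simp add: sum_divide_distrib)
    qed
    then show ?thesis using al by blast
  qed
  obtain a where a: "a \<in> lotteries E" "\<And>t. t \<in> types E \<Longrightarrow>
      lottery_virtual_val E a t = (\<Sum>b\<in>bundles E. max 0 (c b) * phi b t) / N"
    using lottery[of "\<lambda>b. max 0 (c b)"] by fastforce
  obtain a' where a': "a' \<in> lotteries E" "\<And>t. t \<in> types E \<Longrightarrow>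
      lottery_virtual_val E a' t = (\<Sum>b\<in>bundles E. max 0 (- c b) * phi b t) / N"
    using lottery[of "\<lambda>b. max 0 (- c b)"] by fastforce
  have eq: "N * (lottery_virtual_val E a t - lottery_virtual_val E a' t) = (\<Sum>b\<in>bundles E. c b * phi b t)"
    if "t \<in> types E" for t
  proof -
    have "N * (lottery_virtual_val E a t - lottery_virtual_val E a' t)
        = (\<Sum>b\<in>bundles E. (max 0 (c b) - max 0 (- c b)) * phi b t)"
      using N by (simp add: a(2)[OF that] a'(2)[OF that] left_diff_distrib sum_subtractf field_simps)
    also have "\<dots> = (\<Sum>b\<in>bundles E. c b * phi b t)"
      by (rule sum.cong) (auto simp: max_def)
    finally show ?thesis .
  qed
  show ?thesis
    using single_crossing_on_scale[OF A2[OF a(1) a'(1)] N]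
    unfolding single_crossing_on_def monotonic_on_def monotone_on_def by (simp add: eq)
qed

lemma three_term_combination_single_crossing:
  assumes "b \<in> bundles E" "c \<in> bundles E" "d \<in> bundles E"
  shows "single_crossing_on (types E) (\<lambda>t. x * phi b t + y * phi c t + z * phi d t)"
proof -
  have 1: "(\<Sum>e\<in>bundles E. (if e = b' then x' else 0) * phi e t) = x' * phi b' t"
    if "b' \<in> bundles E" for b' x' t
  proof -
    have "(\<Sum>e\<in>bundles E. (if e = b' then x' else 0) * phi e t)
        = (\<Sum>e\<in>bundles E. if e = b' then x' * phi e t else 0)"
      by (rule sum.cong) auto
    then show ?thesis using that by simp
  qed
  \<comment> \<open>Adding three indicator coefficients, rather than distinguishing cases, allows
    the bundles to coincide.\<close>
  have "(\<lambda>t. \<Sum>e\<in>bundles E. ((if e = b then x else 0) + (if e = c then y else 0)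
      + (if e = d then z else 0)) * phi e t) = (\<lambda>t. x * phi b t + y * phi c t + z * phi d t)"
    using assms by (simp only: distrib_right sum.distrib 1)
  then show ?thesis
    using linear_combination_single_crossing[of "\<lambda>e. (if e = b then x else 0)
      + (if e = c then y else 0) + (if e = d then z else 0)"] by simp
qed

lemma three_term_combination_zero:
  assumes b: "b \<in> bundles E" "c \<in> bundles E" "d \<in> bundles E"
    and "x * phi b lo + y * phi c lo + z * phi d lo = 0" "x * phi b hi + y * phi c hi + z * phi d hi = 0"
    and t: "t \<in> types E"
  shows "x * phi b t + y * phi c t + z * phi d t = 0"
  using single_crossing_between(3)[OF three_term_combination_single_crossing[OF b]
      lo_hi_in_types(1) t lo_hi_in_types(2)] assms by (simp add: types_eq)

text \<open>Agreement at both ends spreads to all types, against \<open>phi_distinct\<close>. In the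
  plane this excludes coinciding points, hence ties that no perturbation could break.\<close>

lemma bundle_eq_if_phi_eq:
  assumes b: "b \<in> bundles E" "c \<in> bundles E" and "phi b lo = phi c lo" "phi b hi = phi c hi"
  shows "b = c"
proof (rule ccontr)
  assume "b \<noteq> c"
  from phi_distinct[OF b this] obtain t where t: "t \<in> types E" "phi b t \<noteq> phi c t" by (elim bexE)
  then show False using three_term_combination_zero[OF b b(2), of 1 "-1" 0 t] assms by simp
qed

text \<open>Two bundles with different zero types span all virtual values.  In the resulting coordinates
  \<open>(phi b lo, phi b hi)\<close>, a type acts as the linear functional \<open>(\<alpha> t, \<beta> t)\<close>.\<close>

lemma coordinates:
  assumes r: "r \<in> bundles E" "r \<noteq> {}" and G: "G \<in> bundles E" "G \<noteq> {}"
    and zr: "zero_type r \<noteq> zero_type G"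
  obtains \<alpha> \<beta> where "continuous_on (types E) \<alpha>" "continuous_on (types E) \<beta>"
    "\<alpha> lo = 1" "\<alpha> hi = 0" "\<beta> lo = 0" "\<beta> hi = 1"
    "\<And>t. t \<in> types E \<Longrightarrow> 0 \<le> \<alpha> t" "\<And>t. t \<in> types E \<Longrightarrow> 0 \<le> \<beta> t"
    "\<And>t. t \<in> types E \<Longrightarrow> 0 < \<alpha> t + \<beta> t"
    "\<And>b t. b \<in> bundles E \<Longrightarrow> t \<in> types E \<Longrightarrow> phi b t = \<alpha> t * phi b lo + \<beta> t * phi b hi"
proof -
  \<comment> \<open>The determinant of the end values of \<open>r\<close> and \<open>G\<close>. If
    it were 0, a combination of \<open>phi r\<close> and \<open>phi G\<close> would vanish at all
    types, and the zero of \<open>phi r\<close> would also be that of \<open>phi G\<close>.\<close>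
  define D where "D = phi r lo * phi G hi - phi r hi * phi G lo"
  have D: "D \<noteq> 0"
  proof
    assume "D = 0"
    then have "phi r lo * phi G hi = phi r hi * phi G lo" by (simp add: D_def)
    then have "- phi G hi * phi r (zero_type r) + phi r hi * phi G (zero_type r)
        + 0 * phi G (zero_type r) = 0"
      by (intro three_term_combination_zero[OF r(1) G(1) G(1) _ _ zero_type(1)[OF r]])
        (simp_all add: mult.commute)
    then have "phi r hi * phi G (zero_type r) = 0" using zero_type(2)[OF r] by simp
    then have "phi G (zero_type r) = 0" using phi_pos_hi[OF r] by simp
    then show False using zero_type_unique[OF G zero_type(1)[OF r]] zr by simp
  qed
  \<comment> \<open>Cramer's rule for expressing \<open>(phi r t, phi G t)\<close> through the end
    values of \<open>r\<close> and \<open>G\<close>.\<close>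
  define \<alpha> where "\<alpha> t = (phi G hi * phi r t - phi r hi * phi G t) / D" for t
  define \<beta> where "\<beta> t = (phi r lo * phi G t - phi G lo * phi r t) / D" for t
  have D\<alpha>: "D * \<alpha> t = phi G hi * phi r t - phi r hi * phi G t"
    and D\<beta>: "D * \<beta> t = phi r lo * phi G t - phi G lo * phi r t" for t
    using D by (simp_all add: \<alpha>_def \<beta>_def)
  have eqs: "\<alpha> = (\<lambda>t. phi G hi / D * phi r t + - phi r hi / D * phi G t + 0 * phi G t)"
    "\<beta> = (\<lambda>t. phi r lo / D * phi G t + - phi G lo / D * phi r t + 0 * phi r t)"
    by (simp_all add: fun_eq_iff \<alpha>_def \<beta>_def diff_divide_distrib)
  have sc: "single_crossing_on (types E) \<alpha>" "single_crossing_on (types E) \<beta>"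
    unfolding eqs by (rule three_term_combination_single_crossing r(1) G(1))+
  have ends: "\<alpha> lo = 1" "\<alpha> hi = 0" "\<beta> lo = 0" "\<beta> hi = 1"
    unfolding \<alpha>_def \<beta>_def using D by (simp_all add: D_def mult.commute)
  have rep: "phi b t = \<alpha> t * phi b lo + \<beta> t * phi b hi" if b: "b \<in> bundles E" and t: "t \<in> types E" for b t
  proof -
    have "D * phi b t + - (phi G hi * phi b lo - phi G lo * phi b hi) * phi r t
        + - (phi r lo * phi b hi - phi r hi * phi b lo) * phi G t = 0"
      by (rule three_term_combination_zero[OF b r(1) G(1) _ _ t]) (simp_all add: D_def algebra_simps)
    then have "D * phi b t = (D * \<alpha> t) * phi b lo + (D * \<beta> t) * phi b hi"
      unfolding D\<alpha> D\<beta> by (simp add: algebra_simps)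
    then have "D * phi b t = D * (\<alpha> t * phi b lo + \<beta> t * phi b hi)" by (simp add: distrib_left)
    then show ?thesis using D by simp
  qed
  \<comment> \<open>End values 0 and 1 leave a single-crossing function no room to become
    negative.\<close>
  have nn: "0 \<le> \<alpha> t" "0 \<le> \<beta> t" if t: "t \<in> types E" for t
    using single_crossing_between(1)[OF sc(1) lo_hi_in_types(1) t lo_hi_in_types(2)]
      single_crossing_between(1)[OF sc(2) lo_hi_in_types(1) t lo_hi_in_types(2)] ends t
    by (simp_all add: types_eq)
  have cont: "continuous_on (types E) \<alpha>" "continuous_on (types E) \<beta>"
    unfolding eqs by (intro continuous_on_add continuous_on_mult_left phi_continuous r(1) G(1))+
  have pos: "0 < \<alpha> t + \<beta> t" if t: "t \<in> types E" for t
  proof (rule ccontr)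
    assume "\<not> 0 < \<alpha> t + \<beta> t"
    then have "\<alpha> t = 0" "\<beta> t = 0" using nn[OF t] by linarith+
    then have "phi r t = 0" "phi G t = 0" using rep[OF r(1) t] rep[OF G(1) t] by simp_all
    then show False using zero_type_unique[OF r t] zero_type_unique[OF G t] zr by simp
  qed
  show ?thesis by (rule that[OF cont ends]) (fact nn pos rep)+
qed

text \<open>\<open>p * \<beta> t - q * \<alpha> t\<close> runs continuously from \<open>- q\<close>
  at \<open>lo\<close> to \<open>p\<close> at \<open>hi\<close>, so it vanishes somewhere. There
  \<open>(\<alpha> t, \<beta> t)\<close> is parallel to \<open>(p, q)\<close>, and the factor
  \<open>k\<close> is the ratio of the two coordinate sums, both positive.\<close>

lemma every_direction_attained:
  assumes r: "r \<in> bundles E" "r \<noteq> {}" and G: "G \<in> bundles E" "G \<noteq> {}"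
    and zr: "zero_type r \<noteq> zero_type G" and p: "0 \<le> p" "0 \<le> q" "0 < p + q"
  obtains t k where "t \<in> types E" "0 < k"
    "\<And>b. b \<in> bundles E \<Longrightarrow> phi b t = k * (p * phi b lo + q * phi b hi)"
proof -
  obtain \<alpha> \<beta> where c: "continuous_on (types E) \<alpha>" "continuous_on (types E) \<beta>"
    and ends: "\<alpha> lo = 1" "\<alpha> hi = 0" "\<beta> lo = 0" "\<beta> hi = 1"
    and nn: "\<And>t. t \<in> types E \<Longrightarrow> 0 \<le> \<alpha> t" "\<And>t. t \<in> types E \<Longrightarrow> 0 \<le> \<beta> t"
    and pos: "\<And>t. t \<in> types E \<Longrightarrow> 0 < \<alpha> t + \<beta> t"
    and rep: "\<And>b t. b \<in> bundles E \<Longrightarrow> t \<in> types E \<Longrightarrow> phi b t = \<alpha> t * phi b lo + \<beta> t * phi b hi"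
    by (fact coordinates[OF r G zr])
  have "continuous_on {lo..hi} (\<lambda>t. p * \<beta> t - q * \<alpha> t)"
    using c unfolding types_eq by (intro continuous_intros)
  then obtain t where "lo \<le> t" "t \<le> hi" and h: "p * \<beta> t - q * \<alpha> t = 0"
    using IVT'[of "\<lambda>t. p * \<beta> t - q * \<alpha> t" lo 0 hi] ends p lo_less_hi by auto
  then have t: "t \<in> types E" by (simp add: types_eq)
  define k where "k = (\<alpha> t + \<beta> t) / (p + q)"
  have "\<alpha> t = k * p" "\<beta> t = k * q" using h p by (simp_all add: k_def field_simps)
  then have "phi b t = k * (p * phi b lo + q * phi b hi)" if "b \<in> bundles E" for b
    using rep[OF that t] by (simp add: algebra_simps)
  moreover have "0 < k" using pos[OF t] p by (simp add: k_def)
  ultimately show ?thesis using that t by blast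
qed

text \<open>Ties in direction \<open>(p, q)\<close> are broken by a small move towards \<open>(p', q')\<close>.\<close>

lemma exposed_by_perturbation:
  assumes r: "r \<in> bundles E" "r \<noteq> {}" and G: "G \<in> bundles E" "G \<noteq> {}"
    and zr: "zero_type r \<noteq> zero_type G"
    and p: "0 \<le> p" "0 \<le> q" "0 < p + q" and p': "0 \<le> p'" "0 \<le> q'"
    and C: "C \<subseteq> bundles E" and b: "b \<in> bundles E"
    and lex: "\<And>c. c \<in> C \<Longrightarrow> c \<noteq> b \<Longrightarrow>
      p * phi c lo + q * phi c hi < p * phi b lo + q * phi b hi \<or>
      p * phi c lo + q * phi c hi = p * phi b lo + q * phi b hi \<and>
      p' * phi c lo + q' * phi c hi < p' * phi b lo + q' * phi b hi"
  obtains t where "t \<in> types E" "\<And>c. c \<in> C \<Longrightarrow> c \<noteq> b \<Longrightarrow> phi c t < phi b t"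
proof -
  let ?A = "\<lambda>c. (p * phi c lo + q * phi c hi) - (p * phi b lo + q * phi b hi)"
  let ?B = "\<lambda>c. (p' * phi c lo + q' * phi c hi) - (p' * phi b lo + q' * phi b hi)"
  have "\<forall>c\<in>C - {b}. \<forall>\<^sub>F e in at_right 0. ?A c + e * ?B c < 0"
  proof
    fix c assume "c \<in> C - {b}"
    then show "\<forall>\<^sub>F e in at_right 0. ?A c + e * ?B c < 0"
      using lex[of c] by (intro eventually_perturbation_neg) simp
  qed
  moreover have "finite (C - {b})" using finite_subset[OF C] by simp
  ultimately have "\<forall>\<^sub>F e in at_right 0. \<forall>c\<in>C - {b}. ?A c + e * ?B c < 0"
    by (rule eventually_ball_finite[rotated])
  then have "\<forall>\<^sub>F e in at_right 0. 0 < e \<and> (\<forall>c\<in>C - {b}. ?A c + e * ?B c < 0)"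
    using eventually_at_right_less[of "0::real"] by (rule eventually_elim2) simp
  then obtain e :: real where e: "0 < e" and lt: "\<forall>c\<in>C - {b}. ?A c + e * ?B c < 0"
    using eventually_happens'[OF trivial_limit_at_right_real] by blast
  have "0 \<le> e * p'" "0 \<le> e * q'" using e p' by simp_all
  then have dir: "0 \<le> p + e * p'" "0 \<le> q + e * q'" "0 < (p + e * p') + (q + e * q')"
    using p by linarith+
  obtain t k where t: "t \<in> types E" and k: "0 < k"
    and kt: "\<And>b. b \<in> bundles E \<Longrightarrow> phi b t = k * ((p + e * p') * phi b lo + (q + e * q') * phi b hi)"
    by (fact every_direction_attained[OF r G zr dir])
  have "phi c t < phi b t" if c: "c \<in> C" "c \<noteq> b" for c
  proof -
    have "?A c + e * ?B c < 0" using lt c by simp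
    then have "(p + e * p') * phi c lo + (q + e * q') * phi c hi
        < (p + e * p') * phi b lo + (q + e * q') * phi b hi" by (simp add: algebra_simps)
    then show ?thesis using k kt[OF b] kt[of c] C c by auto
  qed
  then show ?thesis using that t by blast
qed

text \<open>Among the best bundles at \<open>t\<close>, one with the largest \<open>phi\<close> at
  \<open>hi\<close> becomes uniquely best when the direction is turned towards
  \<open>(0, 1)\<close>: a rival tied in both comparisons would be the same point of the plane. If
  \<open>\<alpha> t = 0\<close>, the direction is already that of \<open>hi\<close>, where
  \<open>b0\<close> is uniquely best.\<close>

lemma best_meets_essential:
  assumes r: "r \<in> bundles E" "r \<noteq> {}" and G: "G \<in> bundles E" "G \<noteq> {}"
    and zr: "zero_type r \<noteq> zero_type G" and hi: "best hi = {b0}" and t: "t \<in> types E"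
  shows "best t \<inter> essential \<noteq> {}"
proof -
  obtain \<alpha> \<beta> where "continuous_on (types E) \<alpha>" "continuous_on (types E) \<beta>"
    and "\<alpha> lo = 1" "\<alpha> hi = 0" "\<beta> lo = 0" "\<beta> hi = 1"
    and nn': "\<And>t. t \<in> types E \<Longrightarrow> 0 \<le> \<alpha> t" "\<And>t. t \<in> types E \<Longrightarrow> 0 \<le> \<beta> t"
    and pos: "\<And>t. t \<in> types E \<Longrightarrow> 0 < \<alpha> t + \<beta> t"
    and rep': "\<And>b t. b \<in> bundles E \<Longrightarrow> t \<in> types E \<Longrightarrow> phi b t = \<alpha> t * phi b lo + \<beta> t * phi b hi"
    by (fact coordinates[OF r G zr])
  note nn = nn'(1)[OF t] nn'(2)[OF t] pos[OF t] and rep = rep'[OF _ t]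
  show ?thesis
  proof (cases "\<alpha> t = 0")
    case True
    then have "best t = best hi" using nn rep by (auto simp: best_def)
    moreover have "b0 \<in> essential" using hi lo_hi_in_types(2) unfolding essential_def by blast
    ultimately show ?thesis using hi by simp
  next
    case False
    have fin: "finite ((\<lambda>b. phi b hi) ` best t)" using finite_subset[OF best_subset] by simp
    have "(\<lambda>b. phi b hi) ` best t \<noteq> {}" using best_nonempty by simp
    then have "Max ((\<lambda>b. phi b hi) ` best t) \<in> (\<lambda>b. phi b hi) ` best t" by (rule Max_in[OF fin])
    then obtain b where b: "b \<in> best t" and max: "Max ((\<lambda>b. phi b hi) ` best t) = phi b hi"
      by (elim imageE)
    have max_b: "phi c hi \<le> phi b hi" if "c \<in> best t" for c
      unfolding max[symmetric] using that by (intro Max_ge fin) (rule imageI)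
    have bb: "b \<in> bundles E" using b best_subset by blast
    obtain s where s: "s \<in> types E" "\<And>c. c \<in> bundles E \<Longrightarrow> c \<noteq> b \<Longrightarrow> phi c s < phi b s"
    proof (rule exposed_by_perturbation[OF r G zr nn, of 0 1 "bundles E" b])
      fix c assume c: "c \<in> bundles E" "c \<noteq> b"
      show "\<alpha> t * phi c lo + \<beta> t * phi c hi < \<alpha> t * phi b lo + \<beta> t * phi b hi \<or>
        \<alpha> t * phi c lo + \<beta> t * phi c hi = \<alpha> t * phi b lo + \<beta> t * phi b hi \<and>
        0 * phi c lo + 1 * phi c hi < 0 * phi b lo + 1 * phi b hi"
      proof (rule ccontr)
        assume neg: "\<not> ?thesis"
        have le: "phi c t \<le> phi b t" using bestD[OF b c(1)] .
        then have eq: "phi c t = phi b t" using neg rep[OF c(1)] rep[OF bb] by auto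
        then have "c \<in> best t" using b c(1) by (simp add: best_def)
        then have hi_eq: "phi c hi = phi b hi"
          using max_b[of c] neg eq rep[OF c(1)] rep[OF bb] by auto
        then have "\<alpha> t * phi c lo = \<alpha> t * phi b lo" using eq rep[OF c(1)] rep[OF bb] by simp
        then have "phi c lo = phi b lo" using False by simp
        then show False using bundle_eq_if_phi_eq[OF c(1) bb] hi_eq c(2) by simp
      qed
    qed (use bb in auto)
    have "best s = {b}" by (rule best_eq_singletonI[OF bb s(2)])
    then have "b \<in> essential" using s(1) unfolding essential_def by blast
    then show ?thesis using b by blast
  qed
qed

end

subsection \<open>The tree of bundles\<close>

text \<open>The two strict slope inequalities say that \<open>(0, 0)\<close>, \<open>(l1, m1)\<close>, \<open>(l2, m2)\<close>, \<open>(1, 1)\<close> is a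
  strictly convex chain; its first and last sides have the other two vertices strictly above them.\<close>

lemma convex_chain:
  fixes l1 l2 m1 m2 :: real
  assumes l: "0 < l1" "l1 < l2" "l2 < 1"
    and s: "m1 / l1 < (m2 - m1) / (l2 - l1)" "(m2 - m1) / (l2 - l1) < (1 - m2) / (1 - l2)"
  shows "m1 < l1" "m1 * l2 < l1 * m2" "m2 < l2" "(1 - m2) * l1 - (1 - l2) * m1 < l2 - m2"
proof -
  have a: "m1 * (l2 - l1) < (m2 - m1) * l1" using s(1) l by (simp add: field_simps)
  have b: "(m2 - m1) * (1 - l2) < (1 - m2) * (l2 - l1)" using s(2) l by (simp add: field_simps)
  show "m1 * l2 < l1 * m2" using a by (simp add: algebra_simps)
  show "(1 - m2) * l1 - (1 - l2) * m1 < l2 - m2" using b by (simp add: algebra_simps)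
  \<comment> \<open>A first slope of at least 1 makes the middle slope exceed 1; then
    \<open>m2\<close> is above \<open>l2\<close>, and the last slope is below 1, against
    convexity.\<close>
  show m1: "m1 < l1"
  proof (rule ccontr)
    assume "\<not> m1 < l1"
    then have "l1 * (l2 - l1) \<le> m1 * (l2 - l1)" using l by (intro mult_right_mono) auto
    then have "(l2 - l1) * l1 < (m2 - m1) * l1" using a by (simp add: mult.commute)
    then have gap: "l2 - l1 < m2 - m1" using l by simp
    then have "1 - m2 < 1 - l2" using \<open>\<not> m1 < l1\<close> by simp
    then have "(1 - m2) * (l2 - l1) < (1 - l2) * (l2 - l1)" using l by simp
    also have "\<dots> < (1 - l2) * (m2 - m1)" using gap l by simp
    finally show False using b by (simp add: mult.commute)
  qed
  \<comment> \<open>Otherwise \<open>m1 < l1\<close> makes the middle slope exceed 1; then so does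
    the last one, which puts \<open>m2\<close> below \<open>l2\<close> after all.\<close>
  show "m2 < l2"
  proof (rule ccontr)
    assume "\<not> m2 < l2"
    then have "l2 - l1 < m2 - m1" using m1 by simp
    then have "(1 - l2) * (l2 - l1) < (1 - l2) * (m2 - m1)" using l by simp
    also have "\<dots> < (1 - m2) * (l2 - l1)" using b by (simp add: mult.commute)
    finally have "1 - l2 < 1 - m2" using l by simp
    then show False using \<open>\<not> m2 < l2\<close> by simp
  qed
qed

locale tree_pricing_problem = single_crossing_pricing_problem +
  fixes r :: "nat set" and i :: nat
  assumes root: "r \<in> bundles E"
    and R1: "{r} = {b. is_arg_max (sold_alone_quantity E) (\<lambda>b. b \<in> bundles E) b}"
    and R2: "\<And>b. b \<in> bundles E \<Longrightarrow> \<not> r \<subseteq> b \<Longrightarrow> val E b (type_hi E) < val E r (type_hi E)"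
    and increasing: "\<And>b1 b2. r \<subseteq> b1 \<Longrightarrow> b1 \<subset> b2 \<Longrightarrow> b2 \<subseteq> goods E \<Longrightarrow>
      val E b1 (type_hi E) < val E b2 (type_hi E)"
    and i_in: "i \<in> goods E" and i_notin: "i \<notin> r"
    and branching: "branching_condition E r i"
begin

abbreviation "G \<equiv> goods E"

lemma r_subset: "r \<subset> G"
  using root i_in i_notin by (auto simp: bundles_def)

lemma goods_nonempty: "G \<noteq> {}"
  using i_in by blast

section \<open>The root compared with all other bundles\<close>

lemma sold_alone_quantity_eq: "b \<noteq> {} \<Longrightarrow> sold_alone_quantity E b = 1 - F (zero_type b)"
  by (simp add: sold_alone_quantity_def zero_type_def)

lemma sold_alone_quantity_less:
  assumes b: "b \<in> bundles E" "b \<noteq> r"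
  shows "sold_alone_quantity E b < sold_alone_quantity E r"
proof -
  let ?Q = "sold_alone_quantity E"
  have "r \<in> {b. is_arg_max ?Q (\<lambda>b. b \<in> bundles E) b}" unfolding R1[symmetric] by simp
  then have le: "?Q c \<le> ?Q r" if "c \<in> bundles E" for c using that by (simp add: is_arg_max_linorder)
  have "b \<notin> {b. is_arg_max ?Q (\<lambda>b. b \<in> bundles E) b}" unfolding R1[symmetric] using b(2) by simp
  then obtain c where "c \<in> bundles E" "?Q b < ?Q c" using b(1) by (auto simp: is_arg_max_linorder not_le)
  then show ?thesis using le[of c] by simp
qed

text \<open>By convention the empty bundle has quantity 0, which cannot strictly exceed the quantity
  of the grand bundle.\<close>

lemma root_nonempty: "r \<noteq> {}"
proof
  assume "r = {}"
  then have "sold_alone_quantity E G < 0"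
    using sold_alone_quantity_less[OF goods_in_bundles] goods_nonempty
    by (simp add: sold_alone_quantity_def)
  then show False
    using cdf_bounds[OF zero_type(1)[OF goods_in_bundles goods_nonempty]] goods_nonempty
    by (simp add: sold_alone_quantity_eq)
qed

text \<open>(R1) in terms of types: \<open>F\<close> is strictly increasing, so the strictly largest
  quantity means the strictly earliest zero.\<close>

lemma zero_type_root_less:
  assumes b: "b \<in> bundles E" "b \<noteq> {}" "b \<noteq> r"
  shows "zero_type r < zero_type b"
proof (rule ccontr)
  assume "\<not> ?thesis"
  then have "F (zero_type b) \<le> F (zero_type r)"
    using cdf_strict_mono[of "zero_type b" "zero_type r"] zero_type(1)[OF b(1,2)]
      zero_type(1)[OF root root_nonempty]
    by (cases "zero_type b = zero_type r") (simp_all add: types_eq)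
  then show False
    using sold_alone_quantity_less[OF b(1,3)] b(2) root_nonempty by (simp add: sold_alone_quantity_eq)
qed

lemma phi_neg_at_zero_type_root:
  "b \<in> bundles E \<Longrightarrow> b \<noteq> {} \<Longrightarrow> b \<noteq> r \<Longrightarrow> phi b (zero_type r) < 0"
  using phi_neg_before_zero_type zero_type(1)[OF root root_nonempty] zero_type_root_less by simp

lemma phi_root_at_zero_type [simp]: "phi r (zero_type r) = 0"
  by (rule zero_type(2)[OF root root_nonempty])

lemma zero_type_root_in: "zero_type r \<in> types E"
  by (rule zero_type(1)[OF root root_nonempty])

text \<open>For nonempty \<open>b\<close>, \<open>phi r - phi b\<close> is positive at
  \<open>zero_type r\<close> by (R1) and at \<open>hi\<close>, where virtual values are values, by
  (R2); single crossing keeps it positive in between. The empty bundle loses as soon as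
  \<open>phi r\<close> is positive.\<close>

lemma phi_less_root:
  assumes b: "b \<in> bundles E" "\<not> r \<subseteq> b" and t: "t \<in> types E" "zero_type r < t"
  shows "phi b t < phi r t"
proof (cases "b = {}")
  case True
  then show ?thesis using phi_pos_after_zero_type[OF root root_nonempty t] phi_empty[OF t(1)] by simp
next
  case False
  have "b \<noteq> r" using b(2) by blast
  then have "0 < phi r (zero_type r) - phi b (zero_type r)"
    using phi_neg_at_zero_type_root[OF b(1) False] by simp
  moreover have "0 < phi r hi - phi b hi" using R2[OF b] by (simp add: phi_hi)
  ultimately have "0 < phi r t - phi b t"
    using single_crossing_between(2)[OF A1[OF root b(1), THEN conjunct1]
        zero_type_root_in t(1) lo_hi_in_types(2)] t
    by (simp add: types_eq)
  then show ?thesis by simp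
qed

text \<open>\<open>phi b - phi r\<close> is negative at the zero type of the root and positive at
  \<open>hi\<close>, so its sign is increasing and it is negative at all earlier types too.\<close>

lemma superset_order:
  assumes b: "b \<in> bundles E" "r \<subset> b"
  shows "phi r hi < phi b hi"
    and "t \<in> types E \<Longrightarrow> t \<le> zero_type r \<Longrightarrow> phi b t < phi r t"
proof -
  show hi: "phi r hi < phi b hi" using increasing[of r b] b by (simp add: phi_hi bundles_def)
  have "b \<noteq> {}" "b \<noteq> r" using b(2) by blast+
  then have neg: "phi b (zero_type r) - phi r (zero_type r) < 0"
    using phi_neg_at_zero_type_root[OF b(1)] by simp
  assume t: "t \<in> types E" "t \<le> zero_type r"
  have "phi b t - phi r t < 0"
    using single_crossing_neg_before[OF A1[OF b(1) root, THEN conjunct1] t(1) zero_type_root_in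
        lo_hi_in_types(2) t(2)] neg hi zero_type_root_in
    by (simp add: types_eq)
  then show "phi b t < phi r t" by simp
qed

lemma best_hi: "best hi = {G}"
proof (rule best_eq_singletonI[OF goods_in_bundles])
  fix c assume c: "c \<in> bundles E" "c \<noteq> G"
  show "phi c hi < phi G hi"
  proof (cases "r \<subseteq> c")
    case True
    have "c \<subset> G" using c by (auto simp: bundles_def)
    then show ?thesis using increasing[OF True] by (simp add: phi_hi)
  next
    case False
    then show ?thesis
      using R2[OF c(1)] superset_order(1)[OF goods_in_bundles r_subset] by (simp add: phi_hi)
  qed
qed

lemma goods_essential: "G \<in> essential"
  unfolding essential_def using best_hi lo_hi_in_types(2) by blast

text \<open>Just after its zero type the root is the only bundle with positive virtual value: the
  other nonempty bundles, finitely many, turn positive strictly later.\<close>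

lemma root_essential: "r \<in> essential"
proof -
  let ?Z = "zero_type ` (bundles E - {{}, r})"
  have fin: "finite ?Z" by simp
  have "G \<in> bundles E - {{}, r}" using goods_nonempty r_subset by auto
  then have G: "zero_type G \<in> ?Z" by (rule imageI)
  then have "?Z \<noteq> {}" by blast
  moreover have "zero_type r < z" if "z \<in> ?Z" for z using that zero_type_root_less by auto
  ultimately have "zero_type r < Min ?Z" using fin by simp
  then obtain t where t: "zero_type r < t" "t < Min ?Z" using dense by blast
  have "Min ?Z \<le> zero_type G" using fin G by (rule Min_le)
  then have tT: "t \<in> types E"
    using t zero_type_root_in zero_type(1)[OF goods_in_bundles goods_nonempty] by (simp add: types_eq)
  have pos: "0 < phi r t" by (rule phi_pos_after_zero_type[OF root root_nonempty tT t(1)])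
  have "best t = {r}"
  proof (rule best_eq_singletonI[OF root])
    fix c assume c: "c \<in> bundles E" "c \<noteq> r"
    show "phi c t < phi r t"
    proof (cases "c = {}")
      case True
      then show ?thesis using pos phi_empty[OF tT] by simp
    next
      case False
      then have "c \<in> bundles E - {{}, r}" using c by simp
      then have "zero_type c \<in> ?Z" by (rule imageI)
      then have "Min ?Z \<le> zero_type c" by (rule Min_le[OF fin])
      then have "phi c t < 0" using t by (intro phi_neg_before_zero_type[OF c(1) False tT]) simp
      then show ?thesis using pos by simp
    qed
  qed
  then show ?thesis unfolding essential_def using tT by blast
qed

text \<open>A nonempty bundle not containing the root is beaten at every type: before the zero type
  of the root by the empty bundle, at it and after it by the root.\<close>

lemma essential_superset_root:
  assumes b: "b \<in> essential" "b \<noteq> {}"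
  shows "r \<subseteq> b"
proof (rule ccontr)
  assume nr: "\<not> r \<subseteq> b"
  then have "b \<noteq> r" by blast
  have bb: "b \<in> bundles E" by (rule subsetD[OF essential_subset b(1)])
  obtain t where t: "t \<in> types E" "best t = {b}" using b(1) unfolding essential_def by blast
  then have bt: "b \<in> best t" by simp
  have "t \<noteq> zero_type r"
  proof
    assume "t = zero_type r"
    then show False
      using bestD[OF bt root] phi_neg_at_zero_type_root[OF bb b(2) \<open>b \<noteq> r\<close>] by simp
  qed
  moreover have "\<not> zero_type r < t"
    using phi_less_root[OF bb nr t(1)] bestD[OF bt root] by auto
  moreover have "\<not> t < zero_type r"
  proof
    assume "t < zero_type r"
    then have "phi b t < 0"
      using zero_type_root_less[OF bb b(2) \<open>b \<noteq> r\<close>] by (intro phi_neg_before_zero_type[OF bb b(2) t(1)]) simp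
    then show False using bestD[OF bt empty_in_bundles] phi_empty[OF t(1)] by simp
  qed
  ultimately show False by simp
qed

text \<open>A proper superset can beat the root only after the zero type of the root, and there the
  root beats every bundle that does not contain it. The search for a unique maximiser is thus
  confined to supersets of the root.\<close>

lemma essential_if_beats_supersets:
  assumes b: "b \<in> bundles E" "r \<subset> b" and t: "t \<in> types E"
    and beats: "\<And>c. c \<in> bundles E \<Longrightarrow> r \<subseteq> c \<Longrightarrow> c \<noteq> b \<Longrightarrow> phi c t < phi b t"
  shows "b \<in> essential"
proof -
  have r: "phi r t < phi b t" using beats[OF root] b(2) by blast
  then have after: "zero_type r < t" using superset_order(2)[OF b t] by (meson not_less order.asym)
  have "best t = {b}"
  proof (rule best_eq_singletonI[OF b(1)])
    fix c assume c: "c \<in> bundles E" "c \<noteq> b"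
    show "phi c t < phi b t"
    proof (cases "r \<subseteq> c")
      case False
      then show ?thesis using phi_less_root[OF c(1) False t after] r by simp
    qed (rule beats[OF c(1) _ c(2)])
  qed
  then show ?thesis unfolding essential_def using t by blast
qed

section \<open>The two branches and the resulting menu\<close>

lemma zero_type_root_neq_goods: "zero_type r \<noteq> zero_type G"
proof -
  have "G \<noteq> r" using r_subset by blast
  then show ?thesis using zero_type_root_less[OF goods_in_bundles goods_nonempty] by simp
qed

text \<open>In affine coordinates \<open>(x, y)\<close> with the root at \<open>(0, 0)\<close> and
  \<open>G\<close> at \<open>(1, 1)\<close>, the functional \<open>m1 * x - l1 * y\<close> is 0 at
  the root and at \<open>r \<union> {i}\<close> and negative at the other supersets of the root;
  turning towards \<open>hi\<close> breaks the tie for the branch. Likewise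
  \<open>(1 - m2) * x - (1 - l2) * y\<close> is maximal exactly at \<open>G - {i}\<close> and
  \<open>G\<close>, and turning towards \<open>lo\<close> favours the branch.\<close>

lemma branches:
  shows "r \<union> {i} \<in> essential" and "G - {i} \<in> essential" and "\<not> G - {i} \<subseteq> r \<union> {i}"
proof -
  obtain l1 l2 m1 m2 where
    hi1: "phi (r \<union> {i}) hi = l1 * phi G hi + (1 - l1) * phi r hi" and
    hi2: "phi (G - {i}) hi = l2 * phi G hi + (1 - l2) * phi r hi" and
    lo1: "phi (r \<union> {i}) lo = m1 * phi G lo + (1 - m1) * phi r lo" and
    lo2: "phi (G - {i}) lo = m2 * phi G lo + (1 - m2) * phi r lo" and
    unit: "l1 \<in> {0<..<1}" "l2 \<in> {0<..<1}" "m1 \<in> {0<..<1}" "m2 \<in> {0<..<1}" and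
    slopes: "l1 < l2" "m1 / l1 < (m2 - m1) / (l2 - l1)" "(m2 - m1) / (l2 - l1) < (1 - m2) / (1 - l2)" and
    other: "\<forall>c. r \<subset> c \<and> c \<subset> G \<and> c \<notin> {r \<union> {i}, G - {i}} \<longrightarrow>
           (\<exists>lc mc :: real.
              phi c hi = lc * phi G hi + (1 - lc) * phi r hi \<and>
              phi c lo = mc * phi G lo + (1 - mc) * phi r lo \<and>
              (lc, mc) \<in> {(x, y). y > m1 / l1 * x \<and>
                                 y > (1 - m2) / (1 - l2) * x + (m2 - l2) / (1 - l2) \<and>
                                 x \<ge> l1 \<and> y \<le> m2})"
    using branching unfolding branching_condition_def by (elim exE conjE)
  have l: "0 < l1" "l1 < 1" "0 < l2" "l2 < 1" "0 < m1" "m1 < 1" "0 < m2" "m2 < 1" using unit by simp_all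
  note chain = convex_chain[OF l(1) slopes(1) l(4) slopes(2,3)]
  \<comment> \<open>Both are positive: passing from the root to \<open>G\<close> raises
    \<open>phi\<close> at \<open>hi\<close> and lowers it at \<open>lo\<close>. Hence the minus sign
    before \<open>A * y\<close> in \<open>eval\<close>.\<close>
  define dy where "dy = phi G hi - phi r hi"
  define dx where "dx = phi r lo - phi G lo"
  have dy: "0 < dy" using superset_order(1)[OF goods_in_bundles r_subset] by (simp add: dy_def)
  have dx: "0 < dx"
    using superset_order(2)[OF goods_in_bundles r_subset lo_hi_in_types(1)] zero_type_root_in
    by (simp add: dx_def types_eq)
  text \<open>In the functional with coefficients \<open>(A * dy, B * dx)\<close> both coordinates have the same scale.\<close>
  have eval: "(A * dy) * phi c lo + (B * dx) * phi c hi
      = (A * dy) * phi r lo + (B * dx) * phi r hi + (dx * dy) * (B * x - A * y)"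
    if "phi c hi = x * phi G hi + (1 - x) * phi r hi" "phi c lo = y * phi G lo + (1 - y) * phi r lo"
    for c A B x y
    unfolding that dx_def dy_def by (simp add: algebra_simps)
  \<comment> \<open>Clearing the positive denominators \<open>l1\<close> and \<open>1 - l2\<close>
    turns the edge inequalities of the region into bounds on the two functionals to be
    maximised.\<close>
  have coords: "\<exists>x y. phi c hi = x * phi G hi + (1 - x) * phi r hi \<and>
      phi c lo = y * phi G lo + (1 - y) * phi r lo \<and>
      (c = r \<and> x = 0 \<and> y = 0 \<or> c = r \<union> {i} \<and> x = l1 \<and> y = m1 \<or>
       c = G - {i} \<and> x = l2 \<and> y = m2 \<or> c = G \<and> x = 1 \<and> y = 1 \<or>
       m1 * x < l1 * y \<and> (1 - m2) * x - (1 - l2) * y < l2 - m2)"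
    if c: "c \<in> bundles E" "r \<subseteq> c" for c
  proof -
    consider "c = r" | "c = r \<union> {i}" | "c = G - {i}" | "c = G"
      | "r \<subset> c \<and> c \<subset> G \<and> c \<notin> {r \<union> {i}, G - {i}}"
      using c by (auto simp: bundles_def)
    then show ?thesis
    proof cases
      case 1
      then show ?thesis by (intro exI[of _ 0]) simp
    next
      case 2
      then show ?thesis using hi1 lo1 by (intro exI[of _ l1] exI[of _ m1]) simp
    next
      case 3
      then show ?thesis using hi2 lo2 by (intro exI[of _ l2] exI[of _ m2]) simp
    next
      case 4
      then show ?thesis by (intro exI[of _ 1]) simp
    next
      case 5
      then obtain x y where xy: "phi c hi = x * phi G hi + (1 - x) * phi r hi"
        "phi c lo = y * phi G lo + (1 - y) * phi r lo"
        and "(x, y) \<in> {(x, y). y > m1 / l1 * x \<and>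
                         y > (1 - m2) / (1 - l2) * x + (m2 - l2) / (1 - l2) \<and> x \<ge> l1 \<and> y \<le> m2}"
        using other by meson
      then have a: "m1 / l1 * x < y" and b: "(1 - m2) / (1 - l2) * x + (m2 - l2) / (1 - l2) < y" by simp_all
      have "m1 * x < l1 * y" using a l by (simp add: field_simps)
      moreover have "(1 - m2) * x - (1 - l2) * y < l2 - m2"
      proof -
        have "((1 - m2) * x + (m2 - l2)) / (1 - l2) < y" using b by (simp add: add_divide_distrib)
        then have "(1 - m2) * x + (m2 - l2) < y * (1 - l2)" using l by (simp add: pos_divide_less_eq)
        then show ?thesis by (simp add: algebra_simps)
      qed
      ultimately show ?thesis using xy by blast
    qed
  qed
  have P1: "r \<union> {i} \<in> bundles E" "r \<subset> r \<union> {i}"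
    using root i_in i_notin by (auto simp: bundles_def)
  have P2: "G - {i} \<in> bundles E" by (auto simp: bundles_def)
  \<comment> \<open>The coordinate at \<open>hi\<close> is 0 for the root but \<open>l2 > 0\<close>
    for \<open>G - {i}\<close>. So \<open>G - {i}\<close> has a good outside \<open>r\<close> other
    than \<open>i\<close>, which makes the branches incomparable.\<close>
  have "r \<noteq> G - {i}"
  proof
    assume "r = G - {i}"
    then have "phi r hi = phi (G - {i}) hi" by (rule arg_cong[where f = "\<lambda>b. phi b hi"])
    moreover have "phi (G - {i}) hi - phi r hi = l2 * dy"
      unfolding hi2 dy_def by (simp add: algebra_simps)
    ultimately have "l2 * dy = 0" by simp
    then show False using l dy by simp
  qed
  moreover have "r \<subseteq> G - {i}" using r_subset i_notin by blast
  ultimately have P2': "r \<subset> G - {i}" by blast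
  show "\<not> G - {i} \<subseteq> r \<union> {i}" using P2' i_notin by blast
  let ?C = "{c \<in> bundles E. r \<subseteq> c}"
  have C: "?C \<subseteq> bundles E" by blast
  note expose = exposed_by_perturbation[OF root root_nonempty goods_in_bundles goods_nonempty
      zero_type_root_neq_goods _ _ _ _ _ C]
  show "r \<union> {i} \<in> essential"
  proof -
    obtain t where t: "t \<in> types E" "\<And>c. c \<in> ?C \<Longrightarrow> c \<noteq> r \<union> {i} \<Longrightarrow> phi c t < phi (r \<union> {i}) t"
    proof (rule expose[of "l1 * dy" "m1 * dx" 0 1, OF _ _ _ _ _ P1(1)])
      fix c assume c: "c \<in> ?C" "c \<noteq> r \<union> {i}"
      then obtain x y where xy: "phi c hi = x * phi G hi + (1 - x) * phi r hi"
        "phi c lo = y * phi G lo + (1 - y) * phi r lo" and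
        cases: "c = r \<and> x = 0 \<and> y = 0 \<or> c = G - {i} \<and> x = l2 \<and> y = m2 \<or> c = G \<and> x = 1 \<and> y = 1 \<or>
         m1 * x < l1 * y"
        using coords[of c] by blast
      have ev: "(l1 * dy) * phi c lo + (m1 * dx) * phi c hi - ((l1 * dy) * phi (r \<union> {i}) lo
          + (m1 * dx) * phi (r \<union> {i}) hi) = (dx * dy) * (m1 * x - l1 * y)"
        unfolding eval[OF xy] eval[OF hi1 lo1] by simp
      show "(l1 * dy) * phi c lo + (m1 * dx) * phi c hi
          < (l1 * dy) * phi (r \<union> {i}) lo + (m1 * dx) * phi (r \<union> {i}) hi \<or>
        (l1 * dy) * phi c lo + (m1 * dx) * phi c hi
          = (l1 * dy) * phi (r \<union> {i}) lo + (m1 * dx) * phi (r \<union> {i}) hi \<and>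
        0 * phi c lo + 1 * phi c hi < 0 * phi (r \<union> {i}) lo + 1 * phi (r \<union> {i}) hi"
      proof (cases "c = r \<and> x = 0 \<and> y = 0")
        case True
        then show ?thesis using ev superset_order(1)[OF P1] by simp
      next
        case False
        then have "m1 * x < l1 * y" using cases chain by auto
        then have "(dx * dy) * (m1 * x - l1 * y) < 0" using dx dy by (simp add: mult_pos_neg)
        then show ?thesis using ev by linarith
      qed
    qed (use l dx dy in \<open>simp_all add: add_pos_pos\<close>)
    show ?thesis by (rule essential_if_beats_supersets[OF P1 t(1)]) (rule t(2); simp)
  qed
  show "G - {i} \<in> essential"
  proof -
    obtain t where t: "t \<in> types E" "\<And>c. c \<in> ?C \<Longrightarrow> c \<noteq> G - {i} \<Longrightarrow> phi c t < phi (G - {i}) t"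
    proof (rule expose[of "(1 - l2) * dy" "(1 - m2) * dx" 1 0, OF _ _ _ _ _ P2])
      fix c assume c: "c \<in> ?C" "c \<noteq> G - {i}"
      then obtain x y where xy: "phi c hi = x * phi G hi + (1 - x) * phi r hi"
        "phi c lo = y * phi G lo + (1 - y) * phi r lo" and
        cases: "c = r \<and> x = 0 \<and> y = 0 \<or> c = r \<union> {i} \<and> x = l1 \<and> y = m1 \<or> c = G \<and> x = 1 \<and> y = 1 \<or>
         (1 - m2) * x - (1 - l2) * y < l2 - m2"
        using coords[of c] by blast
      have ev: "((1 - l2) * dy) * phi c lo + ((1 - m2) * dx) * phi c hi
          - (((1 - l2) * dy) * phi (G - {i}) lo + ((1 - m2) * dx) * phi (G - {i}) hi)
          = (dx * dy) * ((1 - m2) * x - (1 - l2) * y - (l2 - m2))"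
        unfolding eval[OF xy] eval[OF hi2 lo2] by (simp add: algebra_simps)
      show "((1 - l2) * dy) * phi c lo + ((1 - m2) * dx) * phi c hi
          < ((1 - l2) * dy) * phi (G - {i}) lo + ((1 - m2) * dx) * phi (G - {i}) hi \<or>
        ((1 - l2) * dy) * phi c lo + ((1 - m2) * dx) * phi c hi
          = ((1 - l2) * dy) * phi (G - {i}) lo + ((1 - m2) * dx) * phi (G - {i}) hi \<and>
        1 * phi c lo + 0 * phi c hi < 1 * phi (G - {i}) lo + 0 * phi (G - {i}) hi"
      proof (cases "c = G \<and> x = 1 \<and> y = 1")
        case True
        have "phi (G - {i}) lo - phi G lo = (1 - m2) * dx" using lo2 by (simp add: dx_def algebra_simps)
        also have "0 < \<dots>" using l dx by simp
        finally show ?thesis using ev True by simp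
      next
        case False
        then have "(1 - m2) * x - (1 - l2) * y < l2 - m2" using cases chain by auto
        then have "(dx * dy) * ((1 - m2) * x - (1 - l2) * y - (l2 - m2)) < 0"
          using dx dy by (simp add: mult_pos_neg)
        then show ?thesis using ev by linarith
      qed
    qed (use l dx dy in \<open>simp_all add: add_pos_pos\<close>)
    show ?thesis by (rule essential_if_beats_supersets[OF P2 P2' t(1)]) (rule t(2); simp)
  qed
qed

lemma tree_menu_essential: "tree_menu essential"
  unfolding tree_menu_def
proof (intro conjI)
  show "\<exists>b\<in>essential. b \<noteq> {} \<and> (\<forall>c\<in>essential. c \<noteq> {} \<longrightarrow> b \<subseteq> c)"
    using root_nonempty essential_superset_root by (intro bexI[OF _ root_essential]) simp
  have "\<not> r \<union> {i} \<subseteq> G - {i}" by simp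
  then show "\<exists>b\<in>essential. \<exists>c\<in>essential. \<not> b \<subseteq> c \<and> \<not> c \<subseteq> b"
    using branches(3) by (intro bexI[OF _ branches(1)] bexI[OF _ branches(2)] conjI)
qed

lemma minimal_optimal_menu_iff_essential: "minimal_optimal_menu E B \<longleftrightarrow> B = essential"
  by (rule minimal_optimal_menu_iff)
    (rule best_meets_essential[OF root root_nonempty goods_in_bundles goods_nonempty
      zero_type_root_neq_goods best_hi])

end

theorem theorem4:
  fixes E :: environment and r :: "nat set" and i :: nat
  assumes standing: "standing_assumptions E"
    and A1: "\<And>b b'. b \<in> bundles E \<Longrightarrow> b' \<in> bundles E \<Longrightarrow>
      single_crossing_on (types E) (\<lambda>t. virtual_val E b t - virtual_val E b' t) \<and>
      monotonic_on (types E) (\<lambda>t. val E b t - val E b' t)"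
    and A2: "\<And>a a'. a \<in> lotteries E \<Longrightarrow> a' \<in> lotteries E \<Longrightarrow>
      single_crossing_on (types E) (\<lambda>t. lottery_virtual_val E a t - lottery_virtual_val E a' t)"
    and root: "r \<in> bundles E"
    and R1: "{r} = {b. is_arg_max (sold_alone_quantity E) (\<lambda>b. b \<in> bundles E) b}"
    and R2: "\<And>b. b \<in> bundles E \<Longrightarrow> \<not> r \<subseteq> b \<Longrightarrow> val E b (type_hi E) < val E r (type_hi E)"
    and increasing: "\<And>b1 b2. r \<subseteq> b1 \<Longrightarrow> b1 \<subset> b2 \<Longrightarrow> b2 \<subseteq> goods E \<Longrightarrow>
      val E b1 (type_hi E) < val E b2 (type_hi E)"
    and least_favorite: "least_favorite_good E r i"
    and branching: "branching_condition E r i"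
  shows "(\<exists>!B. minimal_optimal_menu E B) \<and>
    (\<forall>B. minimal_optimal_menu E B \<longrightarrow>
      tree_menu B \<and> {r, r \<union> {i}, goods E - {i}, goods E} \<subseteq> B)"
proof -
  \<comment> \<open>As a member of its own argmin set, \<open>i\<close> satisfies the side
    constraint there: it is a good outside the root.\<close>
  have "{i} = {j. is_arg_min (\<lambda>j. val E (r \<union> {j}) (type_hi E)) (\<lambda>j. j \<in> goods E \<and> r \<union> {j} \<noteq> r) j}"
    using least_favorite unfolding least_favorite_good_def by (elim conjE)
  from equalityD1[OF this]
  have "is_arg_min (\<lambda>j. val E (r \<union> {j}) (type_hi E)) (\<lambda>j. j \<in> goods E \<and> r \<union> {j} \<noteq> r) i"
    by blast
  then have i: "i \<in> goods E" "r \<union> {i} \<noteq> r" by (simp_all add: is_arg_min_def)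
  then have "i \<notin> r" by blast
  interpret tree_pricing_problem E r i
    by unfold_locales (fact standing A1 A2 root R1 R2 increasing i(1) \<open>i \<notin> r\<close> branching)+
  show ?thesis
    using tree_menu_essential root_essential goods_essential branches(1,2)
    by (simp add: minimal_optimal_menu_iff_essential)
qed

end
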